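(* Let $0<s<1$ be rational. Let $B\subseteq\omega^\omega$ be a basis for $\Sigma^1_1$, and let $E\subseteq2^\omega$ be a $\Sigma^1_1$ class with $\mathcal H^s(E)>0$. Then there exists $f\in B$ such that $E$ has a $\Pi^0_1(f)$ subclass $C$ with $\mathcal H^s(C)>0$. In particular (taking $B=\{x: x\le_T\mathcal O\}$), every $\Sigma^1_1$ class of non-zero $\mathcal H^s$-measure has a $\Pi^0_1(\mathcal O)$ subclass of non-zero $\mathcal H^s$-measure.
   Context: A set $B\subseteq\omega^\omega$ is a basis for $\Sigma^1_1$ if every nonempty (lightface) $\Sigma^1_1$ subset of $\omega^\omega$ has a member in $B$. $\mathcal O$ is Kleene's $\mathcal O$ (a $\Pi^1_1$-complete set). Cantor space $2^\omega$ carries the metric $d(x,y)=2^{-\min\{n:x(n)\ne y(n)\}}$ for $x\ne y$; $\mathcal H^s$ denotes $s$-dimensional Hausdorff measure with respect to this metric. *)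

theory Defs
  imports "HOL-Analysis.Analysis" "HOL-Library.Nat_Bijection"
begin

datatype recf =
    Zero | Succ | Proj nat | Comp recf "recf list"
  | PrimRec recf recf | Minimize recf | Oracle

inductive eval :: "(nat \<Rightarrow> nat) \<Rightarrow> recf \<Rightarrow> nat list \<Rightarrow> nat \<Rightarrow> bool" for g where
  ev_zero: "eval g Zero xs 0"
| ev_succ: "eval g Succ (x # xs) (Suc x)"
| ev_proj: "i < length xs \<Longrightarrow> eval g (Proj i) xs (xs ! i)"
| ev_oracle: "eval g Oracle (x # xs) (g x)"
| ev_comp: "length ys = length hs \<Longrightarrow> (\<forall>i < length hs. eval g (hs ! i) xs (ys ! i))
            \<Longrightarrow> eval g f ys z \<Longrightarrow> eval g (Comp f hs) xs z"
| ev_prim0: "eval g b xs y \<Longrightarrow> eval g (PrimRec b st) (0 # xs) y"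
| ev_primS: "eval g (PrimRec b st) (n # xs) y \<Longrightarrow> eval g st (n # y # xs) z
            \<Longrightarrow> eval g (PrimRec b st) (Suc n # xs) z"
| ev_min: "eval g f (n # xs) 0 \<Longrightarrow> (\<forall>m < n. \<exists>k. eval g f (m # xs) (Suc k))
            \<Longrightarrow> eval g (Minimize f) xs n"

definition total_rec_in :: "(nat \<Rightarrow> nat) \<Rightarrow> nat \<Rightarrow> (nat list \<Rightarrow> nat) \<Rightarrow> bool" where
  "total_rec_in g k h \<longleftrightarrow> (\<exists>e. \<forall>xs. length xs = k \<longrightarrow> eval g e xs (h xs))"

definition pred_rec_in :: "(nat \<Rightarrow> nat) \<Rightarrow> nat \<Rightarrow> (nat list \<Rightarrow> bool) \<Rightarrow> bool" where
  "pred_rec_in g k P \<longleftrightarrow> total_rec_in g k (\<lambda>xs. if P xs then 1 else 0)"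

definition no_oracle :: "nat \<Rightarrow> nat" where "no_oracle = (\<lambda>_. 0)"

definition char_fun :: "nat set \<Rightarrow> nat \<Rightarrow> nat" where
  "char_fun A = (\<lambda>n. if n \<in> A then 1 else 0)"

definition seqcode :: "(nat \<Rightarrow> nat) \<Rightarrow> nat \<Rightarrow> nat" where
  "seqcode x n = list_encode (map x [0..<n])"

definition b2n :: "(nat \<Rightarrow> bool) \<Rightarrow> nat \<Rightarrow> nat" where
  "b2n X = (\<lambda>i. if X i then 1 else 0)"

text \<open>Lightface Sigma^1_1 subsets of Baire space (Kleene normal form).\<close>
definition Sigma11 :: "(nat \<Rightarrow> nat) set \<Rightarrow> bool" where
  "Sigma11 A \<longleftrightarrow> (\<exists>R. pred_rec_in no_oracle 2 R \<and>
     A = {x. \<exists>y. \<forall>n. R [seqcode x n, seqcode y n]})"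

definition Sigma11_cantor :: "(nat \<Rightarrow> bool) set \<Rightarrow> bool" where
  "Sigma11_cantor E \<longleftrightarrow> Sigma11 (b2n ` E)"

definition basis_Sigma11 :: "(nat \<Rightarrow> nat) set \<Rightarrow> bool" where
  "basis_Sigma11 B \<longleftrightarrow> (\<forall>A. Sigma11 A \<and> A \<noteq> {} \<longrightarrow> A \<inter> B \<noteq> {})"

definition Pi01_in :: "(nat \<Rightarrow> nat) \<Rightarrow> (nat \<Rightarrow> bool) set \<Rightarrow> bool" where
  "Pi01_in f C \<longleftrightarrow> (\<exists>R. pred_rec_in f 1 R \<and> C = {X. \<forall>n. R [seqcode (b2n X) n]})"

definition Pi11_nat :: "nat set \<Rightarrow> bool" where
  "Pi11_nat P \<longleftrightarrow> (\<exists>R. pred_rec_in no_oracle 2 R \<and>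
     P = {n. \<forall>y. \<exists>m. R [n, seqcode y m]})"

definition Pi11_complete :: "nat set \<Rightarrow> bool" where
  "Pi11_complete Ob \<longleftrightarrow> Pi11_nat Ob \<and>
     (\<forall>P. Pi11_nat P \<longrightarrow> (\<exists>h. total_rec_in no_oracle 1 (\<lambda>xs. h (hd xs)) \<and>
                                 (\<forall>n. n \<in> P \<longleftrightarrow> h n \<in> Ob)))"

definition cantor_dist :: "(nat \<Rightarrow> bool) \<Rightarrow> (nat \<Rightarrow> bool) \<Rightarrow> real" where
  "cantor_dist X Y = (if X = Y then 0 else (1/2) ^ (LEAST n. X n \<noteq> Y n))"

definition cdiam :: "(nat \<Rightarrow> bool) set \<Rightarrow> real" where
  "cdiam U = (if U = {} then 0 else Sup {cantor_dist X Y | X Y. X \<in> U \<and> Y \<in> U})"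

definition hausdorff_delta :: "real \<Rightarrow> real \<Rightarrow> (nat \<Rightarrow> bool) set \<Rightarrow> ennreal" where
  "hausdorff_delta s \<delta> E = Inf {(\<Sum>i. ennreal (cdiam (U i) powr s)) | U.
       E \<subseteq> (\<Union>i. U i) \<and> (\<forall>i. cdiam (U i) \<le> \<delta>)}"

definition hausdorff :: "real \<Rightarrow> (nat \<Rightarrow> bool) set \<Rightarrow> ennreal" where
  "hausdorff s E = Sup {hausdorff_delta s \<delta> E | \<delta>. \<delta> > 0}"

end

theory Submission
  imports Defs
begin

text \<open>For \<open>s = p/q\<close> the Hausdorff measure of a set vanishes iff its content does, where the content
  is the infimum of the costs of covers by cylinders, a cylinder of length \<open>k\<close> costing
  \<open>2 ^ -(p * k div q)\<close>. Write \<open>E\<close> as the projection of the body of a recursive tree of pairs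
  \<open>(X, y)\<close>. The content is continuous along increasing unions, so bounding the witness one value at
  a time yields an \<open>f\<close> such that the compact set of all \<open>X\<close> with a witness \<open>y \<le> f\<close> has content
  above a fixed \<open>2 ^ -t\<close>. That set is \<open>\<Pi>\<^sup>0\<^sub>1(f)\<close> by Koenig's lemma, and by compactness having content
  at least \<open>2 ^ -t\<close> is a \<open>\<Pi>\<^sup>0\<^sub>1\<close> condition on \<open>f\<close>, which the basis therefore meets. The
  functions recursive in a \<open>\<Pi>\<^sup>1\<^sub>1\<close>-complete set \<open>Ob\<close> form a basis, since the leftmost path through the
  extendible nodes of a recursive tree is recursive in \<open>Ob\<close>.\<close>

section \<open>Relative recursiveness\<close>

text \<open>Positivity of Hausdorff measure involves a limit over ever finer covers, whereas for a
  compact set a content below 2^-t is witnessed by a single finite cover. Hence the condition on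
  \<open>f\<close> is closed, and some \<open>f\<close> in the basis can replace the one obtained by
  construction, whose complexity is not controlled. The delicate point is continuity of the content:
  the sets of all \<open>X\<close> with a partially bounded witness need not be closed, and the
  content is not additive. Strong subadditivity of cylinder costs takes the place of measurability:
  near-optimal covers of successive sets are merged so that the total excess over the content of the
  current set stays summable, and the minimal heavy strings then give one cover of the union. The
  number t is chosen with 2^-t strictly below the content of \<open>E\<close>. The strict inequality
  survives each bounding step, and the failure of all cheap covers at all finite levels returns the
  weak inequality for the compact set.\<close>

lemma rec_cong:
  assumes "total_rec_in g k h" "\<And>xs. length xs = k \<Longrightarrow> h xs = h' xs"
  shows "total_rec_in g k h'"
  using assms unfolding total_rec_in_def by metis

lemma rec_Comp:
  assumes F: "total_rec_in g (length hs) F" and hs: "\<forall>h\<in>set hs. total_rec_in g k h"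
  shows "total_rec_in g k (\<lambda>xs. F (map (\<lambda>h. h xs) hs))"
proof -
  obtain e where e: "\<And>xs. length xs = length hs \<Longrightarrow> eval g e xs (F xs)"
    using F unfolding total_rec_in_def by blast
  have "\<exists>es. length es = length hs \<and>
      (\<forall>i<length hs. \<forall>xs. length xs = k \<longrightarrow> eval g (es!i) xs ((hs!i) xs))"
  proof -
    have "\<forall>i\<in>{..<length hs}. \<exists>c. \<forall>xs. length xs = k \<longrightarrow> eval g c xs ((hs!i) xs)"
      using hs unfolding total_rec_in_def by (metis lessThan_iff nth_mem)
    then obtain c where c: "\<And>i xs. i < length hs \<Longrightarrow> length xs = k \<Longrightarrow> eval g (c i) xs ((hs!i) xs)"
      by (metis lessThan_iff)
    show ?thesis by (rule exI[of _ "map c [0..<length hs]"]) (simp add: c)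
  qed
  then obtain es where es: "length es = length hs"
    "\<And>i xs. i<length hs \<Longrightarrow> length xs = k \<Longrightarrow> eval g (es!i) xs ((hs!i) xs)" by blast
  have "eval g (Comp e es) xs (F (map (\<lambda>h. h xs) hs))" if "length xs = k" for xs
    by (rule ev_comp[where ys="map (\<lambda>h. h xs) hs"]) (use es e that in auto)
  then show ?thesis unfolding total_rec_in_def by blast
qed

lemma rec_comp1:
  assumes "total_rec_in g 1 (\<lambda>xs. F (xs!0))" "total_rec_in g k a"
  shows "total_rec_in g k (\<lambda>xs. F (a xs))"
  using rec_Comp[of g "[a]" "\<lambda>xs. F (xs!0)" k] assms by simp

lemma rec_comp2:
  assumes "total_rec_in g 2 (\<lambda>xs. F (xs!0) (xs!1))" "total_rec_in g k a" "total_rec_in g k b"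
  shows "total_rec_in g k (\<lambda>xs. F (a xs) (b xs))"
  using rec_Comp[of g "[a,b]" "\<lambda>xs. F (xs!0) (xs!1)" k] assms by (simp add: numeral_2_eq_2)

lemma rec_nth: "i < k \<Longrightarrow> total_rec_in g k (\<lambda>xs. xs!i)"
  unfolding total_rec_in_def by (metis ev_proj)

lemma rec_tl_nth: "Suc i < k \<Longrightarrow> total_rec_in g k (\<lambda>xs. tl xs!i)"
  by (rule rec_cong[OF rec_nth[of "Suc i"]]) (auto simp: nth_tl)

lemma rec_tl2_nth: "Suc (Suc i) < k \<Longrightarrow> total_rec_in g k (\<lambda>xs. tl (tl xs)!i)"
  by (rule rec_cong[OF rec_nth[of "Suc (Suc i)"]]) (auto simp: nth_tl)

lemma rec_tl3_nth: "Suc (Suc (Suc i)) < k \<Longrightarrow> total_rec_in g k (\<lambda>xs. tl (tl (tl xs))!i)"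
  by (rule rec_cong[OF rec_nth[of "Suc (Suc (Suc i))"]]) (auto simp: nth_tl)

text \<open>Under a binder the bound variable is argument 0 and the parameters are the tail. This
  rule lets functions of the parameters alone be used there.\<close>

lemma rec_weaken:
  assumes "total_rec_in g k b" shows "total_rec_in g (Suc k) (\<lambda>ys. b (tl ys))"
proof -
  have "total_rec_in g (length (map (\<lambda>i xs. xs!(Suc i)) [0..<k])) b"
    using assms by simp
  then have "total_rec_in g (Suc k) (\<lambda>xs. b (map (\<lambda>h. h xs) (map (\<lambda>i xs. xs!(Suc i)) [0..<k])))"
    by (rule rec_Comp) (auto intro: rec_nth)
  moreover have "map (\<lambda>i. xs ! Suc i) [0..<k] = tl xs" if "length xs = Suc k" for xs :: "nat list"
    using that by (intro nth_equalityI) (auto simp: nth_tl)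
  ultimately show ?thesis by (elim rec_cong) (simp add: comp_def)
qed

text \<open>Inserts an ignored argument just below the bound variable. It is needed where a function
  of a bound index is used next to a second bound value, such as the accumulator of a
  recursion.\<close>

lemma rec_weaken_Suc:
  assumes "total_rec_in g (Suc k) (\<lambda>ys. F (ys!0) (tl ys))"
  shows "total_rec_in g (Suc (Suc k)) (\<lambda>ys. F (ys!0) (tl (tl ys)))"
proof -
  have "total_rec_in g (length ((\<lambda>ys. ys!0) # map (\<lambda>i xs. xs!(Suc (Suc i))) [0..<k]))
     (\<lambda>ys. F (ys!0) (tl ys))" using assms by simp
  then have "total_rec_in g (Suc (Suc k)) (\<lambda>xs. (\<lambda>ys. F (ys!0) (tl ys))
    (map (\<lambda>h. h xs) ((\<lambda>ys. ys!0) # map (\<lambda>i xs. xs!(Suc (Suc i))) [0..<k])))"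
    by (rule rec_Comp) (auto intro: rec_nth)
  moreover have "map (\<lambda>i. xs ! Suc (Suc i)) [0..<k] = tl (tl xs)"
    if "length xs = Suc (Suc k)" for xs :: "nat list"
    using that by (intro nth_equalityI) (auto simp: nth_tl)
  ultimately show ?thesis by (elim rec_cong) (simp add: comp_def)
qed

lemma rec_Suc: 
  assumes "total_rec_in g k a" shows "total_rec_in g k (\<lambda>xs. Suc (a xs))"
proof -
  have "eval g Succ xs (Suc (xs!0))" if "length xs = 1" for xs
    using ev_succ[of g "hd xs" "tl xs"] that by (cases xs) auto
  then have "total_rec_in g 1 (\<lambda>xs. Suc (xs!0))" unfolding total_rec_in_def by blast
  then show ?thesis using assms by (rule rec_comp1)
qed

lemma rec_const: "total_rec_in g k (\<lambda>xs. c)"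
proof (induction c)
  case 0 then show ?case unfolding total_rec_in_def using ev_zero by blast
next
  case (Suc c) then show ?case by (rule rec_Suc)
qed

lemma rec_oracle:
  assumes "total_rec_in g k a" shows "total_rec_in g k (\<lambda>xs. g (a xs))"
proof -
  have "eval g Oracle xs (g (xs!0))" if "length xs = 1" for xs
    using ev_oracle[of g "hd xs" "tl xs"] that by (cases xs) auto
  then have "total_rec_in g 1 (\<lambda>xs. g (xs!0))" unfolding total_rec_in_def by blast
  then show ?thesis using assms by (rule rec_comp1)
qed

lemma rec_primrec:
  assumes "total_rec_in g k a"
    and "total_rec_in g (Suc (Suc k)) (\<lambda>ys. st (ys!0) (tl ys!0) (tl (tl ys)))"
  shows "total_rec_in g (Suc k) (\<lambda>xs. rec_nat (a (tl xs)) (\<lambda>n y. st n y (tl xs)) (xs!0))"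
proof -
  obtain e1 where e1: "\<And>xs. length xs = k \<Longrightarrow> eval g e1 xs (a xs)"
    using assms(1) unfolding total_rec_in_def by blast
  obtain e2 where e2: "\<And>xs. length xs = Suc (Suc k) \<Longrightarrow> eval g e2 xs (st (xs!0) (tl xs!0) (tl (tl xs)))"
    using assms(2) unfolding total_rec_in_def by blast
  have *: "eval g (PrimRec e1 e2) (n # xs) (rec_nat (a xs) (\<lambda>n y. st n y xs) n)"
    if "length xs = k" for n xs
  proof (induction n)
    case 0 show ?case using ev_prim0[OF e1[OF that]] by simp
  next
    case (Suc n)
    have "eval g e2 (n # rec_nat (a xs) (\<lambda>n y. st n y xs) n # xs)
       (rec_nat (a xs) (\<lambda>n y. st n y xs) (Suc n))"
      using e2[of "n # rec_nat (a xs) (\<lambda>n y. st n y xs) n # xs"] that by simp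
    from ev_primS[OF Suc this] show ?case .
  qed
  have "eval g (PrimRec e1 e2) xs (rec_nat (a (tl xs)) (\<lambda>n y. st n y (tl xs)) (xs!0))"
    if "length xs = Suc k" for xs
    using *[of "tl xs" "hd xs"] that by (cases xs) auto
  then show ?thesis unfolding total_rec_in_def by blast
qed

lemma rec_rec_nat:
  assumes "total_rec_in g k a" "total_rec_in g k b"
    and "total_rec_in g (Suc (Suc k)) (\<lambda>ys. st (ys!0) (tl ys!0) (tl (tl ys)))"
  shows "total_rec_in g k (\<lambda>xs. rec_nat (a xs) (\<lambda>n y. st n y xs) (b xs))"
proof -
  have "total_rec_in g (length (b # map (\<lambda>i xs. xs!i) [0..<k]))
    (\<lambda>xs. rec_nat (a (tl xs)) (\<lambda>n y. st n y (tl xs)) (xs!0))"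
    using rec_primrec[OF assms(1,3)] by simp
  then have "total_rec_in g k (\<lambda>xs. (\<lambda>xs. rec_nat (a (tl xs)) (\<lambda>n y. st n y (tl xs)) (xs!0))
    (map (\<lambda>h. h xs) (b # map (\<lambda>i xs. xs!i) [0..<k])))"
    by (rule rec_Comp) (auto simp: assms rec_nth)
  then show ?thesis
    by (rule rec_cong) (auto simp: comp_def map_nth)
qed

lemma rec_funpow:
  assumes "total_rec_in g k a" "total_rec_in g k b" "total_rec_in g 1 (\<lambda>xs. st (xs!0))"
  shows "total_rec_in g k (\<lambda>xs. (st ^^ b xs) (a xs))"
proof -
  have eq: "rec_nat u (\<lambda>n y. st y) n = (st ^^ n) u" for u n by (induction n) auto
  have "total_rec_in g (Suc (Suc k)) (\<lambda>ys. st (tl ys!0))"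
    by (rule rec_comp1[OF assms(3)]) (simp add: rec_tl_nth)
  from rec_rec_nat[OF assms(1,2) this] show ?thesis by (simp add: eq)
qed

lemma rec_pred:
  assumes "total_rec_in g k a" shows "total_rec_in g k (\<lambda>xs. a xs - 1)"
proof -
  have eq: "rec_nat 0 (\<lambda>n y. n) m = m - 1" for m by (cases m) auto
  show ?thesis
    using rec_rec_nat[OF rec_const[of g k 0] assms, of "\<lambda>n y xs. n"]
    by (simp add: eq rec_nth)
qed

lemma rec_minus:
  assumes "total_rec_in g k a" "total_rec_in g k b" shows "total_rec_in g k (\<lambda>xs. a xs - b xs)"
proof -
  have eq: "((\<lambda>x. x - 1) ^^ n) m = m - n" for m n :: nat by (induction n) auto
  show ?thesis
    using rec_funpow[OF assms rec_pred[OF rec_nth[of 0]]] by (simp only: eq zero_less_one)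
qed

lemma rec_add:
  assumes "total_rec_in g k a" "total_rec_in g k b" shows "total_rec_in g k (\<lambda>xs. a xs + b xs)"
proof -
  have eq: "(Suc ^^ n) m = m + n" for m n :: nat by (induction n) auto
  show ?thesis
    using rec_funpow[OF assms rec_Suc[OF rec_nth[of 0]]] by (simp only: eq zero_less_one)
qed

lemma rec_sum:
  assumes "total_rec_in g k b" "total_rec_in g (Suc k) (\<lambda>ys. F (ys!0) (tl ys))"
  shows "total_rec_in g k (\<lambda>xs. \<Sum>i<b xs. F i xs)"
proof -
  have eq: "rec_nat 0 (\<lambda>n y. y + F n xs) m = (\<Sum>i<m. F i xs)" for xs m by (induction m) auto
  have "total_rec_in g (Suc (Suc k)) (\<lambda>ys. tl ys!0 + F (ys!0) (tl (tl ys)))"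
    by (intro rec_add rec_tl_nth rec_weaken_Suc assms) auto
  from rec_rec_nat[where st="\<lambda>n y xs. y + F n xs", OF rec_const[of g k 0] assms(1) this] show ?thesis by (simp add: eq)
qed

lemma rec_mult:
  assumes "total_rec_in g k a" "total_rec_in g k b" shows "total_rec_in g k (\<lambda>xs. a xs * b xs)"
proof -
  have "total_rec_in g 2 (\<lambda>xs. \<Sum>i<xs!0. xs!1)"
    by (intro rec_sum rec_nth rec_tl_nth) auto
  from rec_comp2[OF _ assms, of "\<lambda>x y. \<Sum>i<x. y"] this show ?thesis by simp
qed

lemma rec_power:
  assumes "total_rec_in g k a" shows "total_rec_in g k (\<lambda>xs. c ^ a xs)"
proof -
  have eq: "((\<lambda>x. c * x) ^^ n) 1 = c ^ n" for n :: nat by (induction n) auto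
  show ?thesis
    using rec_funpow[OF rec_const[of g k 1] assms rec_mult[OF rec_const[of g 1 c] rec_nth[of 0]]]
    by (simp only: eq zero_less_one)
qed

section \<open>Decidable predicates, minimization and bounded quantifiers\<close>

lemma pred_cong:
  assumes "pred_rec_in g k P" "\<And>xs. length xs = k \<Longrightarrow> P xs = P' xs"
  shows "pred_rec_in g k P'"
  using assms(1) unfolding pred_rec_in_def by (rule rec_cong) (simp add: assms(2))

lemma pred_le:
  assumes "total_rec_in g k a" "total_rec_in g k b" shows "pred_rec_in g k (\<lambda>xs. a xs \<le> b xs)"
proof -
  have "total_rec_in g k (\<lambda>xs. 1 - (a xs - b xs))" by (intro rec_minus rec_const assms)
  then show ?thesis unfolding pred_rec_in_def by (rule rec_cong) auto
qed

lemma pred_not: "pred_rec_in g k P \<Longrightarrow> pred_rec_in g k (\<lambda>xs. \<not> P xs)"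
proof -
  assume "pred_rec_in g k P"
  then have "total_rec_in g k (\<lambda>xs. 1 - (if P xs then 1 else 0))" unfolding pred_rec_in_def
    by (intro rec_minus rec_const)
  then show ?thesis unfolding pred_rec_in_def by (rule rec_cong) auto
qed

lemma pred_conj: "pred_rec_in g k P \<Longrightarrow> pred_rec_in g k Q \<Longrightarrow> pred_rec_in g k (\<lambda>xs. P xs \<and> Q xs)"
proof -
  assume "pred_rec_in g k P" "pred_rec_in g k Q"
  then have "total_rec_in g k (\<lambda>xs. (if P xs then 1 else 0) * (if Q xs then 1 else 0))" unfolding pred_rec_in_def
    by (intro rec_mult)
  then show ?thesis unfolding pred_rec_in_def by (rule rec_cong) auto
qed

lemma pred_disj: "pred_rec_in g k P \<Longrightarrow> pred_rec_in g k Q \<Longrightarrow> pred_rec_in g k (\<lambda>xs. P xs \<or> Q xs)"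
  by (rule pred_cong[OF pred_not[OF pred_conj[OF pred_not pred_not]], of g k P Q]) auto

lemma pred_imp: "pred_rec_in g k P \<Longrightarrow> pred_rec_in g k Q \<Longrightarrow> pred_rec_in g k (\<lambda>xs. P xs \<longrightarrow> Q xs)"
  unfolding imp_conv_disj by (intro pred_disj pred_not)

lemma pred_less:
  "total_rec_in g k a \<Longrightarrow> total_rec_in g k b \<Longrightarrow> pred_rec_in g k (\<lambda>xs. a xs < b xs)"
  using pred_not[OF pred_le[of g k b a]] by (simp add: not_le)

lemma pred_eq:
  "total_rec_in g k a \<Longrightarrow> total_rec_in g k b \<Longrightarrow> pred_rec_in g k (\<lambda>xs. a xs = b xs)"
  using pred_conj[OF pred_le[of g k a b] pred_le[of g k b a]] by (simp add: eq_iff)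

lemma rec_Least:
  assumes P: "pred_rec_in g (Suc k) (\<lambda>ys. P (ys!0) (tl ys))"
    and ex: "\<And>xs. length xs = k \<Longrightarrow> \<exists>v. P v xs"
  shows "total_rec_in g k (\<lambda>xs. LEAST v. P v xs)"
proof -
  \<comment> \<open>\<open>Minimize\<close> looks for a zero and wants successors before it, so it
    is run on the characteristic function of the negation.\<close>
  from pred_not[OF P] obtain e where e: "\<And>ys. length ys = Suc k \<Longrightarrow>
     eval g e ys (if \<not> P (ys!0) (tl ys) then 1 else 0)"
    unfolding pred_rec_in_def total_rec_in_def by blast
  have "eval g (Minimize e) xs (LEAST v. P v xs)" if l: "length xs = k" for xs
  proof (rule ev_min)
    have "P (LEAST v. P v xs) xs" using ex[OF l] by (rule LeastI_ex)
    then show "eval g e ((LEAST v. P v xs) # xs) 0"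
      using e[of "(LEAST v. P v xs) # xs"] l by simp
    show "\<forall>m<LEAST v. P v xs. \<exists>k. eval g e (m # xs) (Suc k)"
    proof (intro allI impI)
      fix m assume "m < (LEAST v. P v xs)"
      then have "\<not> P m xs" by (rule not_less_Least)
      then show "\<exists>k. eval g e (m # xs) (Suc k)" using e[of "m # xs"] l by auto
    qed
  qed
  then show ?thesis unfolding total_rec_in_def by blast
qed

lemma pred_comp1:
  "pred_rec_in g 1 (\<lambda>xs. P (xs!0)) \<Longrightarrow> total_rec_in g k a \<Longrightarrow> pred_rec_in g k (\<lambda>xs. P (a xs))"
  unfolding pred_rec_in_def by (rule rec_comp1)

lemma pred_comp2:
  "pred_rec_in g 2 (\<lambda>xs. P (xs!0) (xs!1)) \<Longrightarrow> total_rec_in g k a \<Longrightarrow> total_rec_in g k b \<Longrightarrow>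
   pred_rec_in g k (\<lambda>xs. P (a xs) (b xs))"
  unfolding pred_rec_in_def by (rule rec_comp2)

lemma pred_bex:
  assumes b: "total_rec_in g k b" and P: "pred_rec_in g (Suc k) (\<lambda>ys. P (ys!0) (tl ys))"
  shows "pred_rec_in g k (\<lambda>xs. \<exists>v<b xs. P v xs)"
proof -
  \<comment> \<open>The disjunct on \<open>b\<close> makes the search total: it stops at
    \<open>b\<close> at the latest, and strictly before \<open>b\<close> exactly when there is a
    witness.\<close>
  have "pred_rec_in g (Suc k) (\<lambda>ys. P (ys!0) (tl ys) \<or> b (tl ys) \<le> ys!0)"
    by (intro pred_disj P pred_le rec_weaken b rec_nth) simp
  from rec_Least[where P="\<lambda>v xs. P v xs \<or> b xs \<le> v", OF this]
  have "total_rec_in g k (\<lambda>xs. LEAST v. P v xs \<or> b xs \<le> v)" by blast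
  from pred_less[OF this b] show ?thesis
  proof (rule pred_cong)
    fix xs
    let ?l = "LEAST v. P v xs \<or> b xs \<le> v"
    have "P ?l xs \<or> b xs \<le> ?l" by (rule LeastI_ex) auto
    moreover have "?l \<le> v" if "P v xs" for v using that by (intro Least_le) auto
    ultimately show "(?l < b xs) = (\<exists>v<b xs. P v xs)" by (meson le_less_trans not_le)
  qed
qed

lemma pred_ball:
  assumes b: "total_rec_in g k b" and P: "pred_rec_in g (Suc k) (\<lambda>ys. P (ys!0) (tl ys))"
  shows "pred_rec_in g k (\<lambda>xs. \<forall>v<b xs. P v xs)"
  by (rule pred_cong[OF pred_not[OF pred_bex[OF b pred_not[OF P]]]]) auto

lemma rec_div:
  assumes "total_rec_in g k a" "total_rec_in g k b" shows "total_rec_in g k (\<lambda>xs. a xs div b xs)"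
proof -
  \<comment> \<open>The disjunct \<open>b = 0\<close> ends the search at 0, which is the value of
    \<open>a div 0\<close>.\<close>
  have eq: "(LEAST v. b = 0 \<or> a < Suc v * b) = a div b" for a b :: nat
  proof (cases "b = 0")
    case False
    then show ?thesis
      by (intro Least_equality)
        (simp_all add: dividend_less_times_div less_Suc_eq_le[symmetric] less_mult_imp_div_less
          mult.commute[of _ b] flip: div_less_iff_less_mult)
  qed auto
  have "total_rec_in g k (\<lambda>xs. LEAST v. b xs = 0 \<or> a xs < Suc v * b xs)"
  proof (rule rec_Least)
    show "pred_rec_in g (Suc k) (\<lambda>ys. b (tl ys) = 0 \<or> a (tl ys) < Suc (ys ! 0) * b (tl ys))"
      by (intro pred_disj pred_eq pred_less rec_mult rec_Suc rec_weaken assms rec_const rec_nth) simp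
    show "\<exists>v. b xs = 0 \<or> a xs < Suc v * b xs" for xs
      by (rule exI[of _ "a xs"]) (cases "b xs", auto)
  qed
  then show ?thesis by (simp only: eq)
qed

text \<open>Only existence of computations is required, so the oracle may be replaced by a program
  without showing that \<^const>\<open>eval\<close> is single-valued.\<close>

fun subst_oracle :: "recf \<Rightarrow> recf \<Rightarrow> recf" where
  "subst_oracle p Zero = Zero"
| "subst_oracle p Succ = Succ"
| "subst_oracle p (Proj i) = Proj i"
| "subst_oracle p (Comp f hs) = Comp (subst_oracle p f) (map (subst_oracle p) hs)"
| "subst_oracle p (PrimRec b st) = PrimRec (subst_oracle p b) (subst_oracle p st)"
| "subst_oracle p (Minimize f) = Minimize (subst_oracle p f)"
| "subst_oracle p Oracle = Comp p [Proj 0]"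

lemma eval_subst_oracle:
  assumes p: "\<And>x. eval f p [x] (g x)"
  shows "eval g e xs y \<Longrightarrow> eval f (subst_oracle p e) xs y"
proof (induction rule: eval.induct)
  case (ev_oracle x xs)
  show ?case
    using eval.ev_proj[of 0 "x#xs" f] p[of x] by (auto intro: eval.ev_comp[where ys="[x]"])
next
  case (ev_comp ys hs xs e z)
  show ?case by simp (rule eval.ev_comp[of ys], use ev_comp in auto)
next
  case (ev_min e n xs)
  show ?case by simp (rule eval.ev_min, use ev_min in auto)
qed (auto intro: eval.intros)

lemma total_rec_in_trans:
  assumes "total_rec_in g k h" and g: "total_rec_in f 1 (\<lambda>xs. g (hd xs))"
  shows "total_rec_in f k h"
proof -
  obtain p where p: "\<And>x. eval f p [x] (g x)"
    using g unfolding total_rec_in_def by (metis length_Cons list.sel(1) list.size(3) One_nat_def)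
  from assms(1) show ?thesis unfolding total_rec_in_def using eval_subst_oracle[of f p g, OF p] by blast
qed

lemma pred_rec_in_trans:
  "pred_rec_in g k P \<Longrightarrow> total_rec_in f 1 (\<lambda>xs. g (hd xs)) \<Longrightarrow> pred_rec_in f k P"
  unfolding pred_rec_in_def by (rule total_rec_in_trans)

lemma rec_no_oracle: "total_rec_in no_oracle k h \<Longrightarrow> total_rec_in f k h"
  by (erule total_rec_in_trans) (simp add: no_oracle_def rec_const)

lemma pred_no_oracle: "pred_rec_in no_oracle k P \<Longrightarrow> pred_rec_in f k P"
  unfolding pred_rec_in_def by (rule rec_no_oracle)

lemmas rec_leaf = rec_nth rec_tl_nth rec_tl2_nth rec_tl3_nth
lemmas rec_arith = rec_Suc rec_add rec_minus rec_mult rec_power rec_div rec_sum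
lemmas pred_logic = pred_le pred_less pred_eq pred_not pred_conj pred_disj pred_imp pred_bex pred_ball

subsection \<open>Operations on codes of finite sequences\<close>

definition fst_code :: "nat \<Rightarrow> nat" where "fst_code m = fst (prod_decode m)"
definition snd_code :: "nat \<Rightarrow> nat" where "snd_code m = snd (prod_decode m)"
definition tl_code :: "nat \<Rightarrow> nat" where "tl_code c = list_encode (tl (list_decode c))"
definition len_code :: "nat \<Rightarrow> nat" where "len_code c = length (list_decode c)"
text \<open>The default 0 beyond the end makes this a total function with known values;
  \<open>!\<close> alone is unspecified there and could not be shown computable.\<close>

definition nth_code :: "nat \<Rightarrow> nat \<Rightarrow> nat" where
  "nth_code c i = (if i < len_code c then list_decode c ! i else 0)"
definition take_code :: "nat \<Rightarrow> nat \<Rightarrow> nat" where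
  "take_code n c = list_encode (take n (list_decode c))"

lemma len_code_encode[simp]: "len_code (list_encode xs) = length xs"
  by (simp add: len_code_def)
lemma nth_code_encode[simp]: "i < length xs \<Longrightarrow> nth_code (list_encode xs) i = xs ! i"
  by (simp add: nth_code_def)
lemma take_code_encode[simp]: "take_code n (list_encode xs) = list_encode (take n xs)"
  by (simp add: take_code_def)

lemma code_eqI:
  assumes "len_code c = len_code d" "\<And>i. i < len_code c \<Longrightarrow> nth_code c i = nth_code d i"
  shows "c = d"
proof -
  have "list_decode c = list_decode d"
    by (rule nth_equalityI) (use assms in \<open>auto simp: len_code_def nth_code_def\<close>)
  then show ?thesis by (metis list_decode_inverse)
qed

lemma rec_prod_encode:
  assumes "total_rec_in g k a" "total_rec_in g k b"
  shows "total_rec_in g k (\<lambda>xs. prod_encode (a xs, b xs))"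
  unfolding prod_encode_def triangle_def
  by simp (intro rec_arith rec_const assms)

lemma rec_fst_code: assumes "total_rec_in g k a" shows "total_rec_in g k (\<lambda>xs. fst_code (a xs))"
proof (rule rec_comp1[OF _ assms])
  \<comment> \<open>Unpairing inverts \<open>prod_encode\<close> by search; each component is at
    most the code, so the inner search may be bounded by \<open>Suc m\<close>.\<close>
  have eq: "(LEAST u. \<exists>v<Suc m. prod_encode (u,v) = m) = fst_code m" for m
  proof (rule Least_equality)
    have "prod_encode (prod_decode m) = m" by simp
    then show "\<exists>v<Suc m. prod_encode (fst_code m,v) = m" unfolding fst_code_def
      by (metis le_prod_encode_2 less_Suc_eq_le prod.collapse)
    show "fst_code m \<le> u" if "\<exists>v<Suc m. prod_encode (u,v) = m" for u
      using that unfolding fst_code_def by (metis fst_conv order_refl prod_encode_inverse)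
  qed
  have "total_rec_in g 1 (\<lambda>xs. LEAST u. \<exists>v<Suc (xs!0). prod_encode (u,v) = xs!0)"
  proof (rule rec_Least)
    show "pred_rec_in g (Suc 1) (\<lambda>ys. \<exists>v<Suc (tl ys ! 0). prod_encode (ys ! 0, v) = tl ys ! 0)"
      by (intro pred_logic rec_arith rec_prod_encode rec_leaf) auto
    show "\<exists>u. \<exists>v<Suc (xs!0). prod_encode (u,v) = xs!0" for xs
      by (metis le_prod_encode_2 less_Suc_eq_le prod.collapse prod_decode_inverse)
  qed
  then show "total_rec_in g 1 (\<lambda>xs. fst_code (xs!0))" by (simp add: eq)
qed

lemma rec_snd_code: assumes "total_rec_in g k a" shows "total_rec_in g k (\<lambda>xs. snd_code (a xs))"
proof (rule rec_comp1[OF _ assms])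
  have eq: "(LEAST v. prod_encode (fst_code m,v) = m) = snd_code m" for m
  proof (rule Least_equality)
    show "prod_encode (fst_code m, snd_code m) = m" unfolding fst_code_def snd_code_def by simp
    show "snd_code m \<le> u" if "prod_encode (fst_code m, u) = m" for u
      using that unfolding snd_code_def by (metis snd_conv order_refl prod_encode_inverse)
  qed
  have "total_rec_in g 1 (\<lambda>xs. LEAST v. prod_encode (fst_code (xs!0),v) = xs!0)"
  proof (rule rec_Least)
    show "pred_rec_in g (Suc 1) (\<lambda>ys. prod_encode (fst_code (tl ys ! 0), ys ! 0) = tl ys ! 0)"
      by (intro pred_logic rec_arith rec_prod_encode rec_fst_code rec_leaf) auto
    show "\<exists>v. prod_encode (fst_code (xs!0),v) = xs!0" for xs
      unfolding fst_code_def by (metis prod.collapse prod_decode_inverse)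
  qed
  then show "total_rec_in g 1 (\<lambda>xs. snd_code (xs!0))" by (simp add: eq)
qed

lemma tl_code_eq: "tl_code c = (if c = 0 then 0 else snd_code (c - 1))"
  by (cases c) (auto simp: tl_code_def snd_code_def split: prod.split)

lemma rec_if:
  assumes "pred_rec_in g k P" "total_rec_in g k a" "total_rec_in g k b"
  shows "total_rec_in g k (\<lambda>xs. if P xs then a xs else b xs)"
proof -
  have "total_rec_in g k (\<lambda>xs. (if P xs then 1 else 0) * a xs + (1 - (if P xs then 1 else 0)) * b xs)"
    by (intro rec_arith rec_const assms assms(1)[unfolded pred_rec_in_def])
  then show ?thesis by (rule rec_cong) auto
qed

lemma rec_tl_code: "total_rec_in g k a \<Longrightarrow> total_rec_in g k (\<lambda>xs. tl_code (a xs))"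
  unfolding tl_code_eq by (intro rec_if pred_logic rec_snd_code rec_arith rec_const)

lemma funpow_tl_code: "(tl_code ^^ n) c = list_encode (drop n (list_decode c))"
  by (induction n) (auto simp: tl_code_def drop_Suc tl_drop)

lemma rec_drop_code:
  "total_rec_in g k n \<Longrightarrow> total_rec_in g k c \<Longrightarrow> 
   total_rec_in g k (\<lambda>xs. list_encode (drop (n xs) (list_decode (c xs))))"
  unfolding funpow_tl_code[symmetric] by (intro rec_funpow rec_tl_code rec_leaf) auto

lemma list_encode_eq_0: "list_encode xs = 0 \<longleftrightarrow> xs = []"
  by (cases xs) auto

lemma rec_len_code: assumes "total_rec_in g k a" shows "total_rec_in g k (\<lambda>xs. len_code (a xs))"
proof -
  have eq: "(LEAST n. list_encode (drop n (list_decode c)) = 0) = len_code c" for c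
    by (rule Least_equality) (auto simp: len_code_def list_encode_eq_0)
  have "total_rec_in g k (\<lambda>xs. LEAST n. list_encode (drop n (list_decode (a xs))) = 0)"
  proof (rule rec_Least)
    show "pred_rec_in g (Suc k) (\<lambda>ys. list_encode (drop (ys ! 0) (list_decode (a (tl ys)))) = 0)"
      by (intro pred_logic rec_drop_code rec_const rec_leaf rec_weaken assms) auto
    show "\<exists>v. list_encode (drop v (list_decode (a xs))) = 0" for xs
      by (rule exI[of _ "length (list_decode (a xs))"]) (simp add: list_encode_eq_0)
  qed
  then show ?thesis by (simp add: eq)
qed

lemma nth_code_eq: "nth_code c i = (if i < len_code c then fst_code (list_encode (drop i (list_decode c)) - 1) else 0)"
proof (cases "i < len_code c")
  case True
  then have "drop i (list_decode c) = list_decode c ! i # drop (Suc i) (list_decode c)"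
    by (simp add: len_code_def Cons_nth_drop_Suc)
  then show ?thesis using True by (simp add: nth_code_def fst_code_def)
qed (simp add: nth_code_def)

lemma rec_nth_code:
  "total_rec_in g k c \<Longrightarrow> total_rec_in g k i \<Longrightarrow> total_rec_in g k (\<lambda>xs. nth_code (c xs) (i xs))"
  unfolding nth_code_eq
  by (intro rec_if pred_logic rec_len_code rec_fst_code rec_arith rec_drop_code rec_const)

text \<open>A sequence is computable from its length and its entries because it is the unique solution
  of its defining equations.\<close>

lemma rec_build:
  assumes n: "total_rec_in g k n" and F: "total_rec_in g (Suc k) (\<lambda>ys. F (ys!0) (tl ys))"
  shows "total_rec_in g k (\<lambda>xs. list_encode (map (\<lambda>i. F i xs) [0..<n xs]))"
proof -
  have eq: "(LEAST c. len_code c = n xs \<and> (\<forall>i<n xs. nth_code c i = F i xs)) =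
     list_encode (map (\<lambda>i. F i xs) [0..<n xs])" for xs
  proof (rule Least_equality)
    fix c assume "len_code c = n xs \<and> (\<forall>i<n xs. nth_code c i = F i xs)"
    then have "c = list_encode (map (\<lambda>i. F i xs) [0..<n xs])" by (auto intro!: code_eqI[of c])
    then show "list_encode (map (\<lambda>i. F i xs) [0..<n xs]) \<le> c" by simp
  qed auto
  have "total_rec_in g k (\<lambda>xs. LEAST c. len_code c = n xs \<and> (\<forall>i<n xs. nth_code c i = F i xs))"
  proof (rule rec_Least)
    show "pred_rec_in g (Suc k) (\<lambda>ys. len_code (ys ! 0) = n (tl ys) \<and>
             (\<forall>i<n (tl ys). nth_code (ys ! 0) i = F i (tl ys)))"
      by (intro pred_logic rec_len_code rec_nth_code rec_leaf rec_weaken n rec_weaken_Suc F) auto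
    show "\<exists>v. len_code v = n xs \<and> (\<forall>i<n xs. nth_code v i = F i xs)" for xs
      by (rule exI[of _ "list_encode (map (\<lambda>i. F i xs) [0..<n xs])"]) auto
  qed
  then show ?thesis by (simp add: eq)
qed

lemma rec_seqcode:
  assumes "total_rec_in g 1 (\<lambda>xs. f (xs!0))" "total_rec_in g k n"
  shows "total_rec_in g k (\<lambda>xs. seqcode f (n xs))"
  unfolding seqcode_def
  by (intro rec_build assms rec_comp1[where F=f] rec_nth) auto

lemma take_code_eq: "take_code n c = list_encode (map (nth_code c) [0..<(if n \<le> len_code c then n else len_code c)])"
  unfolding take_code_def
  by (rule arg_cong[where f=list_encode], rule nth_equalityI) (auto simp: len_code_def nth_code_def)

lemma rec_take_code:
  "total_rec_in g k n \<Longrightarrow> total_rec_in g k c \<Longrightarrow> total_rec_in g k (\<lambda>xs. take_code (n xs) (c xs))"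
  unfolding take_code_eq
  by (intro rec_build rec_if pred_logic rec_len_code rec_nth_code rec_weaken rec_leaf) auto

definition snoc_code :: "nat \<Rightarrow> nat \<Rightarrow> nat" where
  "snoc_code c v = list_encode (list_decode c @ [v])"

lemma snoc_code_eq: "snoc_code c v = list_encode (map (\<lambda>i. if i < len_code c then nth_code c i else v) [0..<Suc (len_code c)])"
  unfolding snoc_code_def
  by (rule arg_cong[where f=list_encode], rule nth_equalityI)
     (auto simp: len_code_def nth_code_def nth_append)

lemma rec_snoc_code:
  "total_rec_in g k c \<Longrightarrow> total_rec_in g k v \<Longrightarrow> total_rec_in g k (\<lambda>xs. snoc_code (c xs) (v xs))"
  unfolding snoc_code_eq
  by (intro rec_build rec_if pred_logic rec_len_code rec_nth_code rec_weaken rec_leaf rec_arith) auto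

definition map_code :: "(nat \<Rightarrow> nat) \<Rightarrow> nat \<Rightarrow> nat" where
  "map_code F c = list_encode (map F (list_decode c))"

lemma map_code_eq: "map_code F c = list_encode (map (\<lambda>i. F (nth_code c i)) [0..<len_code c])"
  unfolding map_code_def
  by (rule arg_cong[where f=list_encode], rule nth_equalityI) (auto simp: len_code_def nth_code_def)

lemma rec_map_code:
  "total_rec_in g 1 (\<lambda>xs. F (xs!0)) \<Longrightarrow> total_rec_in g k c \<Longrightarrow> total_rec_in g k (\<lambda>xs. map_code F (c xs))"
  unfolding map_code_eq
  by (rule rec_build, rule rec_len_code, assumption, rule rec_comp1[where F=F], assumption)
    (intro rec_nth_code rec_weaken rec_leaf, auto)

lemmas rec_codes = rec_fst_code rec_snd_code rec_len_code rec_nth_code rec_take_code rec_snoc_code rec_prod_encode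

section \<open>Contents given by weighted cylinder covers\<close>

definition restr :: "(nat \<Rightarrow> 'a) \<Rightarrow> nat \<Rightarrow> 'a list" where
  "restr X n = map X [0..<n]"

lemma length_restr[simp]: "length (restr X n) = n" by (simp add: restr_def)

lemma nth_restr[simp]: "i < n \<Longrightarrow> restr X n ! i = X i" by (simp add: restr_def)

lemma take_restr[simp]: "take k (restr X n) = restr X (min k n)"
  by (simp add: restr_def take_map min_def)

definition covers :: "bool list set \<Rightarrow> (nat \<Rightarrow> bool) set \<Rightarrow> bool" where
  "covers D A \<longleftrightarrow> (\<forall>X\<in>A. \<exists>n. restr X n \<in> D)"

text \<open>Covering for sets of strings. It is stricter than covering the union of the cylinders:
  the two one-bit strings cover the whole space but do not dominate the empty string. This makes the
  induction along the tree of strings purely combinatorial.\<close>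

definition dominates :: "bool list set \<Rightarrow> bool list set \<Rightarrow> bool" where
  "dominates H V \<longleftrightarrow> (\<forall>\<sigma>\<in>V. \<exists>n\<le>length \<sigma>. take n \<sigma> \<in> H)"

definition ext :: "bool list \<Rightarrow> bool list set" where
  "ext \<rho> = {\<rho> @ l | l. True}"

lemma dominates_refl: "V \<subseteq> H \<Longrightarrow> dominates H V"
  unfolding dominates_def by (metis order_refl subsetD take_all)

lemma dominates_trans:
  assumes "dominates U H" "dominates H V" shows "dominates U V"
  unfolding dominates_def
proof
  fix \<sigma> assume "\<sigma> \<in> V"
  then obtain n where n: "n \<le> length \<sigma>" "take n \<sigma> \<in> H" using assms(2) unfolding dominates_def by blast
  then obtain k where "k \<le> length (take n \<sigma>)" "take k (take n \<sigma>) \<in> U"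
    using assms(1) unfolding dominates_def by blast
  then show "\<exists>k\<le>length \<sigma>. take k \<sigma> \<in> U" using n by (intro exI[of _ k]) (auto simp: min_absorb1)
qed

lemma covers_dominates:
  assumes "dominates H V" "covers V A" shows "covers H A"
  unfolding covers_def
proof
  fix X assume "X \<in> A"
  then obtain n where "restr X n \<in> V" using assms(2) unfolding covers_def by blast
  then obtain k where "take k (restr X n) \<in> H" using assms(1) unfolding dominates_def by blast
  then show "\<exists>n. restr X n \<in> H" by auto
qed

text \<open>Normalization at 0 bounds every content by 1, the cost of the root cylinder; finiteness
  is what later permits cancellation. Antitonicity says that passing to a prefix never saves
  cost.\<close>

locale weight =
  fixes w :: "nat \<Rightarrow> ennreal"
  assumes w_anti: "\<And>m n. m \<le> n \<Longrightarrow> w n \<le> w m" and w_0: "w 0 = 1"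
begin

text \<open>Taking the cost as a measure on the discrete set of strings gives additivity, countable
  subadditivity and continuity from below at once.\<close>

definition mu :: "bool list set \<Rightarrow> ennreal" where
  "mu = emeasure (density (count_space UNIV) (\<lambda>\<sigma>. w (length \<sigma>)))"

definition content :: "(nat \<Rightarrow> bool) set \<Rightarrow> ennreal" where
  "content A = (INF D\<in>{D. covers D A}. mu D)"

definition dom_content :: "bool list set \<Rightarrow> ennreal" where
  "dom_content V = (INF H\<in>{H. dominates H V}. mu H)"

text \<open>Nothing that dominates the part of \<open>V\<close> beyond \<sigma> is cheaper than
  \<sigma> alone.\<close>

definition heavy :: "bool list set \<Rightarrow> bool list \<Rightarrow> bool" where
  "heavy V \<sigma> \<longleftrightarrow> w (length \<sigma>) \<le> dom_content (V \<inter> ext \<sigma>)"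

section \<open>Properties of the cost and of the two contents\<close>

lemma mu_mono: "A \<subseteq> B \<Longrightarrow> mu A \<le> mu B"
  unfolding mu_def by (rule emeasure_mono) auto

lemma mu_singleton: "mu {\<sigma>} = w (length \<sigma>)"
  unfolding mu_def by (subst emeasure_density) (auto simp: nn_integral_count_space_indicator nn_integral_indicator_singleton)

lemma mu_empty[simp]: "mu {} = 0" by (simp add: mu_def)

lemma mu_ge: "\<sigma> \<in> H \<Longrightarrow> w (length \<sigma>) \<le> mu H"
  using mu_mono[of "{\<sigma>}" H] by (simp add: mu_singleton)

lemma mu_Un: "A \<inter> B = {} \<Longrightarrow> mu (A \<union> B) = mu A + mu B"
  unfolding mu_def by (rule plus_emeasure[symmetric]) auto

lemma mu_subadd: "mu (A \<union> B) \<le> mu A + mu B"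
  unfolding mu_def by (rule emeasure_subadditive) auto

lemma mu_UN: "mu (\<Union>i::nat. A i) \<le> (\<Sum>i. mu (A i))"
  unfolding mu_def by (rule emeasure_subadditive_countably) auto

lemma mu_incseq: "incseq A \<Longrightarrow> mu (\<Union>i::nat. A i) = (SUP i. mu (A i))"
  unfolding mu_def by (rule SUP_emeasure_incseq[symmetric]) auto

lemma mu_finite: "finite D \<Longrightarrow> mu D = (\<Sum>\<sigma>\<in>D. w (length \<sigma>))"
proof (induction D rule: finite_induct)
  case (insert x F)
  then show ?case using mu_Un[of "{x}" F] by (simp add: mu_singleton)
qed simp

lemma content_le: "covers D A \<Longrightarrow> content A \<le> mu D"
  unfolding content_def by (rule INF_lower) simp

lemma content_mono: "A \<subseteq> B \<Longrightarrow> content A \<le> content B"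
  unfolding content_def by (rule INF_superset_mono) (auto simp: covers_def)

lemma content_le_1: "content A \<le> 1"
  using content_le[of "{[]}" A] by (simp add: covers_def mu_singleton w_0 restr_def)

lemma content_less: "content A < c \<Longrightarrow> \<exists>D. covers D A \<and> mu D < c"
  unfolding content_def by (auto simp: INF_less_iff)

lemma dom_content_mono: "V \<subseteq> V' \<Longrightarrow> dom_content V \<le> dom_content V'"
  unfolding dom_content_def by (rule INF_superset_mono) (auto simp: dominates_def)

lemma dom_content_le: "dominates H V \<Longrightarrow> dom_content V \<le> mu H"
  unfolding dom_content_def by (rule INF_lower) simp

lemma content_le_dom_content: "covers V A \<Longrightarrow> content A \<le> dom_content V"
  unfolding dom_content_def by (rule INF_greatest) (auto intro: content_le covers_dominates)

text \<open>Strong subadditivity: of two comparable strings, the shorter one serves the union and the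
  longer one the intersection.\<close>

lemma union_inter_covers:
  obtains U I where "mu U + mu I \<le> mu S + mu T" "dominates U (S \<union> T)"
    "\<forall>\<tau> n m. n \<le> length \<tau> \<and> m \<le> length \<tau> \<and> take n \<tau> \<in> S \<and> take m \<tau> \<in> T \<longrightarrow>
       (\<exists>k\<le>length \<tau>. take k \<tau> \<in> I)"
proof -
  \<comment> \<open>The prefix is allowed to be equal in \<open>S2\<close> but must be proper in
    \<open>T2\<close>. A string common to \<open>S\<close> and \<open>T\<close> with no proper
    prefix in \<open>S\<close> then stays in \<open>T - T2\<close> while its other copy goes to
    \<open>S2\<close>; with equality allowed on both sides it would be lost from the union
    part.\<close>
  define S2 where "S2 = {\<sigma>\<in>S. \<exists>n\<le>length \<sigma>. take n \<sigma> \<in> T}"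
  define T2 where "T2 = {\<tau>\<in>T. \<exists>n<length \<tau>. take n \<tau> \<in> S}"
  have S: "mu S = mu (S - S2) + mu S2"
    by (subst mu_Un[symmetric]) (auto simp: S2_def intro: arg_cong[where f=mu])
  have T: "mu T = mu (T - T2) + mu T2"
    by (subst mu_Un[symmetric]) (auto simp: T2_def intro: arg_cong[where f=mu])
  have 1: "mu ((S - S2) \<union> (T - T2)) + mu (S2 \<union> T2) \<le> mu S + mu T"
  proof -
    have "mu ((S - S2) \<union> (T - T2)) + mu (S2 \<union> T2) \<le> (mu (S - S2) + mu (T - T2)) + (mu S2 + mu T2)"
      by (intro add_mono mu_subadd)
    then show ?thesis unfolding S T by (simp add: ac_simps)
  qed
  have 2: "dominates ((S - S2) \<union> (T - T2)) (S \<union> T)"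
    unfolding dominates_def
  proof
    fix \<sigma> assume "\<sigma> \<in> S \<union> T"
    then have ex: "take (length \<sigma>) \<sigma> \<in> S \<union> T" by simp
    define n where "n = (LEAST n. take n \<sigma> \<in> S \<union> T)"
    have n: "take n \<sigma> \<in> S \<union> T" unfolding n_def using ex by (rule LeastI)
    have nle: "n \<le> length \<sigma>" unfolding n_def using ex by (rule Least_le)
    have min: "take k \<sigma> \<notin> S \<union> T" if "k < n" for k using that unfolding n_def by (rule not_less_Least)
    have "take n \<sigma> \<in> (S - S2) \<union> (T - T2)"
    proof (cases "take n \<sigma> \<in> T")
      case True
      have "take n \<sigma> \<notin> T2" unfolding T2_def using min nle by auto
      then show ?thesis using True by simp
    next
      case False
      have "take n \<sigma> \<notin> S2"
      proof
        assume "take n \<sigma> \<in> S2"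
        then obtain k where k: "k \<le> length (take n \<sigma>)" "take k (take n \<sigma>) \<in> T" unfolding S2_def by blast
        then have "k \<le> n" "take k \<sigma> \<in> T" by (auto simp: min_absorb1)
        then show False using False min[of k] by (cases "k = n") auto
      qed
      then show ?thesis using False n by simp
    qed
    then show "\<exists>n\<le>length \<sigma>. take n \<sigma> \<in> (S - S2) \<union> (T - T2)" using nle by blast
  qed
  have 3: "\<exists>k\<le>length \<tau>. take k \<tau> \<in> S2 \<union> T2"
    if "n \<le> length \<tau>" "m \<le> length \<tau>" "take n \<tau> \<in> S" "take m \<tau> \<in> T" for \<tau> n m
  proof (cases "m \<le> n")
    case True
    then have "take n \<tau> \<in> S2" unfolding S2_def using that by (auto intro!: exI[of _ m] simp: min_def)
    then show ?thesis using that by blast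
  next
    case False
    then have "take m \<tau> \<in> T2" unfolding T2_def using that by (auto intro!: exI[of _ n] simp: min_def)
    then show ?thesis using that by blast
  qed
  show ?thesis using that[OF 1 2] 3 by blast
qed

text \<open>If a dominating set contains a string no longer than \<rho>, antitonicity already makes
  it cost the first term. Otherwise its parts beyond the two children of \<rho> are disjoint, and
  each dominates its share of \<open>V\<close>, so the costs add up to at least the second
  term.\<close>

lemma dom_content_split:
  "min (w (length \<rho>)) (dom_content (V \<inter> ext (\<rho> @ [False])) + dom_content (V \<inter> ext (\<rho> @ [True])))
    \<le> dom_content (V \<inter> ext \<rho>)"
  unfolding dom_content_def[of "V \<inter> ext \<rho>"]
proof (rule INF_greatest)
  fix H assume "H \<in> {H. dominates H (V \<inter> ext \<rho>)}"
  then have H: "dominates H (V \<inter> ext \<rho>)" by simp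
  show "min (w (length \<rho>)) (dom_content (V \<inter> ext (\<rho> @ [False])) + dom_content (V \<inter> ext (\<rho> @ [True]))) \<le> mu H"
  proof (cases "\<exists>\<sigma>\<in>H. length \<sigma> \<le> length \<rho>")
    case True
    then show ?thesis by (meson min.coboundedI1 mu_ge order_trans w_anti)
  next
    case False
    have *: "dominates (H \<inter> ext (\<rho> @ [b])) (V \<inter> ext (\<rho> @ [b]))" for b
      unfolding dominates_def
    proof
      fix \<sigma> assume s: "\<sigma> \<in> V \<inter> ext (\<rho> @ [b])"
      then obtain l where l: "\<sigma> = \<rho> @ [b] @ l" unfolding ext_def by auto
      have "\<sigma> \<in> V \<inter> ext \<rho>" using s l unfolding ext_def by auto
      then obtain n where n: "n \<le> length \<sigma>" "take n \<sigma> \<in> H" using H unfolding dominates_def by blast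
      then have "\<not> length (take n \<sigma>) \<le> length \<rho>" using False by blast
      then have "length \<rho> < n" using n by auto
      then have "take n \<sigma> = (\<rho> @ [b]) @ take (n - Suc (length \<rho>)) l" unfolding l by (simp add: take_Cons' Suc_diff_Suc)
      then have "take n \<sigma> \<in> ext (\<rho> @ [b])" unfolding ext_def by blast
      then show "\<exists>n\<le>length \<sigma>. take n \<sigma> \<in> H \<inter> ext (\<rho> @ [b])" using n by blast
    qed
    have "dom_content (V \<inter> ext (\<rho> @ [False])) + dom_content (V \<inter> ext (\<rho> @ [True]))
       \<le> mu (H \<inter> ext (\<rho> @ [False])) + mu (H \<inter> ext (\<rho> @ [True]))"
      by (intro add_mono dom_content_le *)
    also have "\<dots> = mu (H \<inter> ext (\<rho> @ [False]) \<union> H \<inter> ext (\<rho> @ [True]))"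
      by (rule mu_Un[symmetric]) (auto simp: ext_def)
    also have "\<dots> \<le> mu H" by (rule mu_mono) auto
    finally show ?thesis by (rule min.coboundedI2)
  qed
qed

text \<open>Whatever dominates \<sigma> contains a prefix of \<sigma>, and that prefix weighs at
  least as much.\<close>

lemma heavy_self: assumes "\<sigma> \<in> V" shows "heavy V \<sigma>"
  unfolding heavy_def dom_content_def
proof (rule INF_greatest)
  fix H assume "H \<in> {H. dominates H (V \<inter> ext \<sigma>)}"
  then obtain n where "take n \<sigma> \<in> H" using assms unfolding dominates_def ext_def by fastforce
  then have "w (length (take n \<sigma>)) \<le> mu H" by (rule mu_ge)
  moreover have "w (length \<sigma>) \<le> w (length (take n \<sigma>))" by (rule w_anti) simp
  ultimately show "w (length \<sigma>) \<le> mu H" by (rule order_trans[rotated])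
qed

lemma heavy_mono: "V \<subseteq> V' \<Longrightarrow> heavy V \<sigma> \<Longrightarrow> heavy V' \<sigma>"
  unfolding heavy_def by (erule order_trans, rule dom_content_mono) auto

text \<open>Below its own weight the content is additive over subtrees, so the minimal heavy strings
  cannot cost more than the content.\<close>

lemma mu_minimal_heavy_aux:
  assumes "F \<subseteq> ext \<rho>" "\<And>\<sigma>. \<sigma> \<in> F \<Longrightarrow> length \<sigma> \<le> length \<rho> + m" "\<And>\<sigma>. \<sigma> \<in> F \<Longrightarrow> heavy V \<sigma>"
    "\<And>\<sigma> n. \<sigma> \<in> F \<Longrightarrow> length \<rho> \<le> n \<Longrightarrow> n < length \<sigma> \<Longrightarrow> \<not> heavy V (take n \<sigma>)"
  shows "mu F \<le> dom_content (V \<inter> ext \<rho>)"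
  using assms
proof (induction m arbitrary: \<rho> F)
  case 0
  then have "F \<subseteq> {\<rho>}" by (auto simp: ext_def) force+
  then show ?case using "0.prems"(3)[of \<rho>] mu_singleton[of \<rho>] unfolding heavy_def
    by (metis insertI1 mu_empty subset_singletonD zero_le)
next
  case (Suc m)
  show ?case
  proof (cases "F \<subseteq> {\<rho>}")
    case True
    then show ?thesis using "Suc.prems"(3)[of \<rho>] mu_singleton[of \<rho>] unfolding heavy_def
      by (metis insertI1 mu_empty subset_singletonD zero_le)
  next
    case False
    then obtain \<sigma> where s: "\<sigma> \<in> F" "\<sigma> \<noteq> \<rho>" by blast
    then obtain l where l: "\<sigma> = \<rho> @ l" "l \<noteq> []" using Suc.prems(1) by (auto simp: ext_def)
    \<comment> \<open>Since \<rho> is a proper prefix of a member of \<open>F\<close>, it is not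
      heavy. This keeps \<rho> out of \<open>F\<close> and rules out the first term of the minimum
      in \<open>dom_content_split\<close>, leaving the sum over the two children.\<close>
    have "\<not> heavy V (take (length \<rho>) \<sigma>)" using Suc.prems(4)[OF s(1), of "length \<rho>"] l by simp
    then have nh: "\<not> heavy V \<rho>" using l by simp
    then have nF: "\<rho> \<notin> F" using Suc.prems(3) by blast
    have *: "mu (F \<inter> ext (\<rho> @ [b])) \<le> dom_content (V \<inter> ext (\<rho> @ [b]))" for b
      by (rule Suc.IH) (use Suc.prems(2-4) in \<open>fastforce+\<close>)
    have "F = F \<inter> ext (\<rho> @ [False]) \<union> F \<inter> ext (\<rho> @ [True])"
    proof -
      have "x \<in> ext (\<rho> @ [False]) \<union> ext (\<rho> @ [True])" if "x \<in> F" for x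
      proof -
        have "x \<in> ext \<rho>" using Suc.prems(1) that by blast
        then obtain l where l: "x = \<rho> @ l" by (auto simp: ext_def)
        with nF that obtain b l' where "l = b # l'" by (cases l) auto
        then show ?thesis using l by (cases b) (auto simp: ext_def)
      qed
      then show ?thesis by blast
    qed
    moreover have "mu (F \<inter> ext (\<rho> @ [False]) \<union> F \<inter> ext (\<rho> @ [True]))
        \<le> mu (F \<inter> ext (\<rho> @ [False])) + mu (F \<inter> ext (\<rho> @ [True]))"
      by (rule mu_subadd)
    ultimately have "mu F \<le> dom_content (V \<inter> ext (\<rho> @ [False])) + dom_content (V \<inter> ext (\<rho> @ [True]))"
      using add_mono[OF *[of False] *[of True]] by simp
    moreover have "\<dots> \<le> dom_content (V \<inter> ext \<rho>)"
      using dom_content_split[of \<rho> V] nh unfolding heavy_def by (auto simp: min_def split: if_splits)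
    ultimately show ?thesis by (rule order_trans)
  qed
qed

lemma mu_minimal_heavy:
  assumes "\<And>\<sigma>. \<sigma> \<in> F \<Longrightarrow> length \<sigma> \<le> m" "\<And>\<sigma>. \<sigma> \<in> F \<Longrightarrow> heavy V \<sigma>"
    "\<And>\<sigma> n. \<sigma> \<in> F \<Longrightarrow> n < length \<sigma> \<Longrightarrow> \<not> heavy V (take n \<sigma>)"
  shows "mu F \<le> dom_content V"
  using mu_minimal_heavy_aux[of F "[]" m V] assms by (simp add: ext_def)

text \<open>A string that becomes heavy stays heavy, so the minimal strings that are ever heavy form
  one set \<open>H\<close>. It dominates the union, because members of \<open>V n\<close> are heavy
  for \<open>V n\<close>, and by continuity from below its cost is the limit of the costs of its
  finite stages, each bounded by some \<open>dom_content (V n)\<close>.\<close>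

lemma dom_content_incseq:
  assumes V: "incseq V" and c: "\<And>n::nat. dom_content (V n) \<le> c"
  shows "dom_content (\<Union>n. V n) \<le> c"
proof -
  define T where "T = {\<sigma>. \<exists>n. heavy (V n) \<sigma>}"
  define H where "H = {\<sigma>\<in>T. \<forall>k<length \<sigma>. take k \<sigma> \<notin> T}"
  \<comment> \<open>The length bound is what the induction in \<open>mu_minimal_heavy\<close> needs.
    Proper prefixes of members of \<open>H\<close> are heavy at no stage, so minimality holds for
    \<open>V n\<close> as well.\<close>
  define G where "G n = {\<sigma>\<in>H. heavy (V n) \<sigma> \<and> length \<sigma> \<le> n}" for n
  have hm: "heavy (V n) \<sigma> \<Longrightarrow> n \<le> m \<Longrightarrow> heavy (V m) \<sigma>" for n m \<sigma>
    using V heavy_mono by (meson incseq_def)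
  have "dominates H (\<Union>n. V n)" unfolding dominates_def
  proof
    fix \<sigma> assume "\<sigma> \<in> (\<Union>n. V n)"
    then have ex: "take (length \<sigma>) \<sigma> \<in> T" unfolding T_def using heavy_self by auto
    define n where "n = (LEAST n. take n \<sigma> \<in> T)"
    have n: "take n \<sigma> \<in> T" unfolding n_def using ex by (rule LeastI)
    have nle: "n \<le> length \<sigma>" unfolding n_def using ex by (rule Least_le)
    have min: "take k \<sigma> \<notin> T" if "k < n" for k using that unfolding n_def by (rule not_less_Least)
    have "take n \<sigma> \<in> H" unfolding H_def using n min by auto
    then show "\<exists>n\<le>length \<sigma>. take n \<sigma> \<in> H" using nle by blast
  qed
  then have "dom_content (\<Union>n. V n) \<le> mu H" by (rule dom_content_le)
  also have "H = (\<Union>n. G n)"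
  proof
    show "H \<subseteq> (\<Union>n. G n)"
    proof
      fix \<sigma> assume s: "\<sigma> \<in> H"
      then obtain n where "heavy (V n) \<sigma>" unfolding H_def T_def by blast
      then have "\<sigma> \<in> G (max n (length \<sigma>))" unfolding G_def using s hm by auto
      then show "\<sigma> \<in> (\<Union>n. G n)" by blast
    qed
  qed (auto simp: G_def)
  also have "mu (\<Union>n. G n) = (SUP n. mu (G n))"
    by (rule mu_incseq) (auto simp: incseq_def G_def intro: hm)
  also have "\<dots> \<le> c"
  proof (rule SUP_least)
    fix n
    have "mu (G n) \<le> dom_content (V n)"
      by (rule mu_minimal_heavy[of _ n]) (auto simp: G_def H_def T_def)
    then show "mu (G n) \<le> c" using c[of n] by (rule order_trans)
  qed
  finally show ?thesis .
qed

text \<open>The sets are arbitrary. Near-optimal covers chosen separately for the \<open>A n\<close>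
  need not be related, and their union could be far too expensive; strong subadditivity merges them
  at the price of the accumulated errors only, after which \<open>dom_content_incseq\<close> treats
  the union of the covers.\<close>

lemma content_incseq:
  assumes A: "incseq A" and c: "\<And>n::nat. content (A n) \<le> c"
  shows "content (\<Union>n. A n) \<le> c"
proof (rule ennreal_le_epsilon)
  fix e :: real assume e: "0 < e"
  have fin: "content B \<noteq> top" for B using content_le_1[of B] by (auto simp: top_unique)
  have "\<exists>D. covers D (A n) \<and> mu D \<le> content (A n) + ennreal (e * (1/2) ^ Suc n)" for n
  proof -
    have "content (A n) < content (A n) + ennreal (e * (1/2) ^ Suc n)"
      using fin[of "A n"] e by (simp add: ennreal_lessI less_top)
    from content_less[OF this] show ?thesis by (auto intro: less_imp_le)
  qed
  then obtain D where D: "\<And>n. covers (D n) (A n)"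
    and muD: "\<And>n. mu (D n) \<le> content (A n) + ennreal (e * (1/2) ^ Suc n)" by metis
  define V where "V n = (\<Union>i\<le>n. D i)" for n
  \<comment> \<open>The errors e/2, e/4, ... allowed at the successive stages add up to the excess
    stated here, which never reaches e.\<close>
  have *: "\<exists>H. dominates H (V n) \<and> mu H \<le> content (A n) + ennreal (e * (1 - (1/2) ^ Suc n))" for n
  proof (induction n)
    case 0
    show ?case by (rule exI[of _ "D 0"]) (use muD[of 0] in \<open>auto simp: V_def intro: dominates_refl\<close>)
  next
    case (Suc n)
    then obtain H where H: "dominates H (V n)"
      and muH: "mu H \<le> content (A n) + ennreal (e * (1 - (1/2) ^ Suc n))" by blast
    obtain U I where UI: "mu U + mu I \<le> mu H + mu (D (Suc n))" and U: "dominates U (H \<union> D (Suc n))"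
      and I: "\<forall>\<tau> n' m. n' \<le> length \<tau> \<and> m \<le> length \<tau> \<and> take n' \<tau> \<in> H \<and> take m \<tau> \<in> D (Suc n) \<longrightarrow>
       (\<exists>k\<le>length \<tau>. take k \<tau> \<in> I)" by (rule union_inter_covers[where S=H and T="D (Suc n)"])
    have "covers (V n) (A n)" using D[of n] unfolding covers_def V_def by blast
    then have cH: "covers H (A n)" using H covers_dominates by blast
    \<comment> \<open>Both \<open>H\<close> and \<open>D (Suc n)\<close> cover \<open>A n\<close>,
      because the sets increase. The intersection part therefore costs at least
      \<open>content (A n)\<close>, and this amount cancels against the bound on
      \<open>H\<close>.\<close>
    have "covers I (A n)" unfolding covers_def
    proof
      fix X assume X: "X \<in> A n"
      then have "X \<in> A (Suc n)" using A by (meson incseq_SucD subsetD)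
      then obtain b where b: "restr X b \<in> D (Suc n)" using D[of "Suc n"] unfolding covers_def by blast
      obtain a where a: "restr X a \<in> H" using cH X unfolding covers_def by blast
      show "\<exists>k. restr X k \<in> I"
        using I[rule_format, of a "restr X (max a b)" b] a b by auto
    qed
    then have "content (A n) \<le> mu I" by (rule content_le)
    then have "content (A n) + mu U \<le> mu H + mu (D (Suc n))"
      using UI by (metis add.commute add_left_mono order_trans)
    also have "\<dots> \<le> (content (A n) + ennreal (e * (1 - (1/2) ^ Suc n))) +
        (content (A (Suc n)) + ennreal (e * (1/2) ^ Suc (Suc n)))"
      by (intro add_mono muH muD)
    also have "\<dots> = content (A n) + (content (A (Suc n)) + 
       (ennreal (e * (1 - (1/2) ^ Suc n)) + ennreal (e * (1/2) ^ Suc (Suc n))))"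
      by (simp add: ac_simps)
    finally have "mu U \<le> content (A (Suc n)) + 
       (ennreal (e * (1 - (1/2) ^ Suc n)) + ennreal (e * (1/2) ^ Suc (Suc n)))"
      using fin[of "A n"] by (simp add: ennreal_add_left_cancel_le)
    also have "ennreal (e * (1 - (1/2) ^ Suc n)) + ennreal (e * (1/2) ^ Suc (Suc n)) =
       ennreal (e * (1 - (1/2) ^ Suc (Suc n)))"
    proof (subst ennreal_plus[symmetric])
      show "0 \<le> e * (1 - (1/2) ^ Suc n)"
        using e by (intro mult_nonneg_nonneg) (auto simp: power_le_one simp del: power_Suc)
    qed (use e in \<open>auto simp: algebra_simps\<close>)
    finally have "mu U \<le> content (A (Suc n)) + ennreal (e * (1 - (1/2) ^ Suc (Suc n)))" .
    moreover have "dominates U (V (Suc n))"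
    proof -
      have "dominates (H \<union> D (Suc n)) (V (Suc n))"
        using H unfolding dominates_def V_def
        by (auto simp: atMost_Suc)
      then show ?thesis using U dominates_trans by blast
    qed
    ultimately show ?case by blast
  qed
  have "dom_content (V n) \<le> c + ennreal e" for n
  proof -
    obtain H where "dominates H (V n)" "mu H \<le> content (A n) + ennreal (e * (1 - (1/2) ^ Suc n))"
      using * by blast
    then have "dom_content (V n) \<le> content (A n) + ennreal (e * (1 - (1/2) ^ Suc n))"
      using dom_content_le order_trans by blast
    moreover have "e * (1 - (1/2) ^ Suc n) \<le> e * 1"
      by (rule mult_left_mono) (use e in auto)
    then have "content (A n) + ennreal (e * (1 - (1/2) ^ Suc n)) \<le> c + ennreal e"
      by (intro add_mono c ennreal_leI) simp
    ultimately show ?thesis by (meson order_trans)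
  qed
  moreover have "incseq V" unfolding V_def by (intro monoI UN_mono) auto
  ultimately have "dom_content (\<Union>n. V n) \<le> c + ennreal e"
    by (intro dom_content_incseq)
  moreover have "covers (\<Union>n. V n) (\<Union>n. A n)"
    unfolding covers_def
  proof
    fix X assume "X \<in> (\<Union>n. A n)"
    then obtain n m where "restr X m \<in> D n" using D unfolding covers_def by blast
    then have "restr X m \<in> V n" by (auto simp: V_def)
    then show "\<exists>m. restr X m \<in> (\<Union>n. V n)" by blast
  qed
  ultimately show "content (\<Union>n. A n) \<le> c + ennreal e"
    using content_le_dom_content order_trans by blast
qed

end

section \<open>Hausdorff measure and content\<close>

definition cyl :: "bool list \<Rightarrow> (nat \<Rightarrow> bool) set" where
  "cyl \<sigma> = {X. restr X (length \<sigma>) = \<sigma>}"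

lemma cantor_dist_le:
  assumes "restr X n = restr Y n" shows "cantor_dist X Y \<le> (1/2) ^ n"
proof (cases "X = Y")
  case False
  then have ex: "\<exists>k. X k \<noteq> Y k" by blast
  have "X k = Y k" if "k < n" for k using assms that by (metis nth_restr)
  then have "n \<le> (LEAST k. X k \<noteq> Y k)" using LeastI_ex[OF ex] not_le by blast
  then show ?thesis using False by (auto simp: cantor_dist_def intro: power_decreasing)
qed (simp add: cantor_dist_def)

lemma cdiam_cyl: "cdiam (cyl \<sigma>) \<le> (1/2) ^ length \<sigma>"
proof (cases "cyl \<sigma> = {}")
  case False
  then show ?thesis unfolding cdiam_def
    by (auto intro!: cSup_least cantor_dist_le simp: cyl_def)
qed (simp add: cdiam_def)

lemma cantor_dist_le_cdiam:
  assumes "X \<in> U" "Y \<in> U" shows "cantor_dist X Y \<le> cdiam U"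
proof -
  have "bdd_above {cantor_dist X Y |X Y. X \<in> U \<and> Y \<in> U}"
    by (rule bdd_aboveI[of _ 1]) (use cantor_dist_le[of _ 0] in \<open>auto simp: restr_def\<close>)
  then show ?thesis using assms unfolding cdiam_def by (auto intro!: cSup_upper)
qed

lemma cdiam_nonneg: "0 \<le> cdiam U"
proof (cases "U = {}")
  case False
  then obtain X where "X \<in> U" by blast
  then show ?thesis using cantor_dist_le_cdiam[of X U X] by (simp add: cantor_dist_def)
qed (simp add: cdiam_def)

text \<open>Rounding the exponent keeps the weights dyadic, so that costs of finite covers can be
  compared by integer arithmetic, and changes the content by a factor of at most 2.\<close>

definition dyadic_weight :: "nat \<Rightarrow> nat \<Rightarrow> nat \<Rightarrow> ennreal" where
  "dyadic_weight p q k = ennreal ((1/2) ^ (p * k div q))"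

lemma weight_dyadic: "weight (dyadic_weight p q)"
  by unfold_locales (auto simp: dyadic_weight_def intro!: ennreal_leI power_decreasing div_le_mono)

lemma powr_le_dyadic:
  assumes "0 < q" shows "((1/2::real) ^ k) powr (real p / real q) \<le> (1/2) ^ (p * k div q)"
    and "(1/2) ^ (p * k div q) \<le> 2 * ((1/2::real) ^ k) powr (real p / real q)"
proof -
  define m where "m = p * k div q"
  have "m * q \<le> p * k" by (simp add: m_def)
  then have "real m * real q \<le> real p * real k" by (simp only: of_nat_mult[symmetric] of_nat_le_iff)
  then have 1: "real m \<le> real k * (real p / real q)"
    using assms by (simp add: field_simps)
  have "p * k < Suc m * q" unfolding m_def using assms by (simp add: dividend_less_div_times)
  then have "real p * real k \<le> real (Suc m) * real q"
    by (simp only: of_nat_mult[symmetric] of_nat_le_iff)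
  then have 2: "real k * (real p / real q) \<le> real (Suc m)"
    using assms by (simp add: field_simps)
  have eq: "((1/2::real) ^ k) powr (real p / real q) = (1/2) powr (real k * (real p / real q))"
    by (simp add: powr_realpow[symmetric] powr_powr)
  have "(1/2::real) powr (real k * (real p / real q)) \<le> (1/2) powr (real m)"
    by (rule powr_mono') (use 1 in auto)
  then show "((1/2::real) ^ k) powr (real p / real q) \<le> (1/2) ^ (p * k div q)"
    unfolding eq m_def[symmetric] by (simp add: powr_realpow)
  have "(1/2::real) powr (real (Suc m)) \<le> (1/2) powr (real k * (real p / real q))"
    by (rule powr_mono') (use 2 in auto)
  moreover have "(1/2::real) powr (real (Suc m)) = (1/2) ^ Suc m" by (rule powr_realpow) simp
  ultimately show "(1/2) ^ (p * k div q) \<le> 2 * ((1/2::real) ^ k) powr (real p / real q)"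
    unfolding eq m_def[symmetric] by simp
qed

text \<open>A cover that costs less than the weight of length \<open>k\<close> contains only strings
  of length at least \<open>k\<close>. A sufficiently cheap cover is therefore automatically as fine
  as any given \<delta> demands.\<close>

lemma hausdorff_eq_0:
  assumes q: "0 < q" and p: "0 < p" and 0: "weight.content (dyadic_weight p q) E = 0"
  shows "hausdorff (real p / real q) E = 0"
proof -
  interpret weight "dyadic_weight p q" by (rule weight_dyadic)
  let ?s = "real p / real q"
  have *: "hausdorff_delta ?s \<delta> E \<le> 0 + ennreal e" if d: "\<delta> > 0" and e: "e > 0" for \<delta> e :: real
  proof -
    obtain k where k: "(1/2::real) ^ k < \<delta>" using real_arch_pow_inv[OF d, of "1/2"] by auto
    have "content E < min (ennreal e) (dyadic_weight p q k)"
      using 0 e by (simp add: dyadic_weight_def)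
    then obtain D where D: "covers D E" "mu D < min (ennreal e) (dyadic_weight p q k)"
      using content_less by blast
    have len: "k \<le> length \<sigma>" if "\<sigma> \<in> D" for \<sigma>
    proof (rule ccontr)
      assume "\<not> k \<le> length \<sigma>"
      then have "dyadic_weight p q k \<le> dyadic_weight p q (length \<sigma>)" by (intro w_anti) simp
      also have "\<dots> \<le> mu D" using that by (rule mu_ge)
      finally show False using D(2) by (meson leD min_less_iff_conj)
    qed
    define f where "f = (from_nat_into UNIV :: nat \<Rightarrow> bool list)"
    have bij: "bij_betw f UNIV UNIV" unfolding f_def
      by (rule bij_betw_from_nat_into) (auto simp: infinite_UNIV_listI)
    \<comment> \<open>The Hausdorff covers are indexed by all naturals, so all strings are
      enumerated and those outside \<open>D\<close> contribute the empty set, whose cost is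
      0.\<close>
    define U where "U i = (if f i \<in> D then cyl (f i) else {})" for i
    have "E \<subseteq> (\<Union>i. U i)"
    proof
      fix X assume "X \<in> E"
      then obtain n where n: "restr X n \<in> D" using D unfolding covers_def by blast
      obtain i where "f i = restr X n" using bij unfolding bij_betw_def by (metis UNIV_I imageE)
      then have "X \<in> U i" using n by (simp add: U_def cyl_def)
      then show "X \<in> (\<Union>i. U i)" by blast
    qed
    moreover have "cdiam (U i) \<le> \<delta>" for i
    proof (cases "f i \<in> D")
      case True
      then have "cdiam (U i) \<le> (1/2) ^ length (f i)" by (simp add: U_def cdiam_cyl)
      also have "\<dots> \<le> (1/2) ^ k" by (rule power_decreasing) (use len True in auto)
      finally show ?thesis using k by simp
    qed (use d in \<open>simp add: U_def cdiam_def\<close>)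
    ultimately have "hausdorff_delta ?s \<delta> E \<le> (\<Sum>i. ennreal (cdiam (U i) powr ?s))"
      unfolding hausdorff_delta_def by (intro Inf_lower) blast
    also have "\<dots> \<le> (\<Sum>i. dyadic_weight p q (length (f i)) * indicator D (f i))"
    proof (rule suminf_le)
      fix i
      have "cdiam (cyl (f i)) powr ?s \<le> ((1/2) ^ length (f i)) powr ?s"
        by (rule powr_mono2) (auto simp: cdiam_cyl cdiam_nonneg)
      then show "ennreal (cdiam (U i) powr ?s) \<le> dyadic_weight p q (length (f i)) * indicator D (f i)"
        using powr_le_dyadic(1)[OF q, of "length (f i)" p]
        by (cases "f i \<in> D") (auto simp: U_def dyadic_weight_def cdiam_def[of "{}"] intro!: ennreal_leI)
    qed auto
    also have "\<dots> = (\<integral>\<^sup>+i. dyadic_weight p q (length (f i)) * indicator D (f i) \<partial>count_space UNIV)"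
      by (rule nn_integral_count_space_nat[symmetric])
    also have "\<dots> = (\<integral>\<^sup>+\<sigma>. dyadic_weight p q (length \<sigma>) * indicator D \<sigma> \<partial>count_space UNIV)"
      by (rule nn_integral_bij_count_space[OF bij])
    also have "\<dots> = mu D" unfolding mu_def by (rule emeasure_density[symmetric]) auto
    also have "\<dots> \<le> ennreal e" using D(2) by (meson less_imp_le min_less_iff_conj)
    finally show ?thesis by simp
  qed
  have "hausdorff_delta ?s \<delta> E \<le> 0" if "\<delta> > 0" for \<delta>
    by (rule ennreal_le_epsilon, rule *[OF that])
  then have "hausdorff ?s E \<le> 0" unfolding hausdorff_def by (intro Sup_least) auto
  then show ?thesis by simp
qed

text \<open>A set with two points lies in the cylinder of its longest common prefix, of length k
  say, and contains two points at distance 2^-k; the factor 2 pays for the rounded exponent. Sets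
  with at most one point have diameter 0 while every cylinder has positive weight, whence the
  additional \<open>e\<close>.\<close>

lemma cylinder_of_set:
  assumes q: "0 < q" and p: "0 < p" and e: "0 < (e::real)"
  shows "\<exists>\<sigma>. U \<subseteq> cyl \<sigma> \<and>
     dyadic_weight p q (length \<sigma>) \<le> 2 * ennreal (cdiam U powr (real p / real q)) + ennreal e"
proof (cases "\<exists>k. \<exists>X\<in>U. \<exists>Y\<in>U. X k \<noteq> Y k")
  case nd: False
  obtain X where X: "U \<subseteq> {X}"
  proof (cases "U = {}")
    case True then show ?thesis using that[of undefined] by simp
  next
    case False
    then obtain X where "X \<in> U" by blast
    have "U \<subseteq> {X}"
    proof
      fix Y assume "Y \<in> U"
      then have "Y k = X k" for k using nd \<open>X \<in> U\<close> by blast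
      then show "Y \<in> {X}" by auto
    qed
    then show ?thesis by (rule that)
  qed
  \<comment> \<open>At length \<open>q * m\<close> the rounded exponent is exactly
    \<open>p * m\<close>, which is at least \<open>m\<close>.\<close>
  obtain m where m: "(1/2::real) ^ m < e" using real_arch_pow_inv[OF e, of "1/2"] by auto
  have "(1/2::real) ^ (p * (q * m) div q) \<le> (1/2) ^ m"
  proof (rule power_decreasing)
    have "p * (q * m) div q = p * m" using q by (metis mult.left_commute nonzero_mult_div_cancel_left not_gr0)
    then show "m \<le> p * (q * m) div q" using p by simp
  qed auto
  then have "dyadic_weight p q (q * m) \<le> ennreal e"
    unfolding dyadic_weight_def by (intro ennreal_leI order_trans[OF _ less_imp_le[OF m]])
  moreover have "U \<subseteq> cyl (restr X (q * m))" using X by (auto simp: cyl_def)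
  ultimately show ?thesis by (intro exI[of _ "restr X (q * m)"]) (auto intro: add_increasing)
next
  case True
  define k where "k = (LEAST k. \<exists>X\<in>U. \<exists>Y\<in>U. X k \<noteq> Y k)"
  obtain X Y where XY: "X \<in> U" "Y \<in> U" "X k \<noteq> Y k" using LeastI_ex[OF True] unfolding k_def by blast
  have eq: "X' i = Y' i" if "i < k" "X' \<in> U" "Y' \<in> U" for i X' Y'
    using not_less_Least[OF that(1)[unfolded k_def]] that(2,3) by blast
  have "(LEAST n. X n \<noteq> Y n) = k"
  proof (rule Least_equality)
    show "k \<le> i" if "X i \<noteq> Y i" for i using eq[of i X Y] XY that by (meson not_le)
  qed (rule XY(3))
  moreover have "X \<noteq> Y" using XY(3) by blast
  ultimately have "(1/2) ^ k \<le> cdiam U"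
    using cantor_dist_le_cdiam[OF XY(1,2)] by (simp only: cantor_dist_def if_False)
  then have "((1/2) ^ k) powr (real p / real q) \<le> cdiam U powr (real p / real q)"
    by (intro powr_mono2) auto
  then have "(1/2) ^ (p * k div q) \<le> 2 * cdiam U powr (real p / real q)"
    using powr_le_dyadic(2)[OF q, of p k] by linarith
  then have "dyadic_weight p q k \<le> ennreal (2 * cdiam U powr (real p / real q))"
    unfolding dyadic_weight_def by (rule ennreal_leI)
  also have "\<dots> = 2 * ennreal (cdiam U powr (real p / real q))" by (simp add: ennreal_mult)
  finally have "dyadic_weight p q k \<le> 2 * ennreal (cdiam U powr (real p / real q)) + ennreal e"
    by (rule order_trans) simp
  moreover have "U \<subseteq> cyl (restr X k)"
  proof
    fix Z assume "Z \<in> U"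
    then have "restr Z k = restr X k"
      by (intro nth_equalityI) (simp_all add: eq[OF _ _ XY(1)])
    then show "Z \<in> cyl (restr X k)" by (simp add: cyl_def)
  qed
  ultimately show ?thesis by (intro exI[of _ "restr X k"]) auto
qed

text \<open>Replacing each set of a cover by a cylinder, with errors summing to an arbitrary e,
  shows that every countable cover costs at least half the content. This bounds the premeasure at
  \<delta> = 1, and the Hausdorff measure is a supremum over \<delta>.\<close>

lemma hausdorff_pos:
  assumes q: "0 < q" and p: "0 < p" and pos: "weight.content (dyadic_weight p q) C > 0"
  shows "hausdorff (real p / real q) C > 0"
proof -
  interpret weight "dyadic_weight p q" by (rule weight_dyadic)
  let ?s = "real p / real q"
  obtain c where c: "content C = ennreal c" "0 < c"
    using content_le_1[of C] pos by (cases "content C") (auto simp: top_unique)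
  have "ennreal (c/2) \<le> S" if SU: "S = (\<Sum>i. ennreal (cdiam (U i) powr ?s))" "C \<subseteq> (\<Union>i::nat. U i)" for S U
  proof -
    have "content C \<le> 2 * S"
    proof (rule ennreal_le_epsilon)
      fix e :: real assume e: "0 < e"
      have "\<exists>\<sigma>. U i \<subseteq> cyl \<sigma> \<and>
        dyadic_weight p q (length \<sigma>) \<le> 2 * ennreal (cdiam (U i) powr ?s) + ennreal (e * (1/2) ^ Suc i)" for i
        by (rule cylinder_of_set[OF q p]) (use e in simp)
      then obtain \<sigma> where \<sigma>: "\<And>i. U i \<subseteq> cyl (\<sigma> i)"
        "\<And>i. dyadic_weight p q (length (\<sigma> i)) \<le> 2 * ennreal (cdiam (U i) powr ?s) + ennreal (e * (1/2) ^ Suc i)"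
        by metis
      have "covers (\<Union>i. {\<sigma> i}) C" unfolding covers_def
      proof
        fix X assume "X \<in> C"
        then obtain i where "X \<in> cyl (\<sigma> i)" using SU(2) \<sigma>(1) by blast
        then show "\<exists>n. restr X n \<in> (\<Union>i. {\<sigma> i})" unfolding cyl_def by auto
      qed
      then have "content C \<le> mu (\<Union>i. {\<sigma> i})" by (rule content_le)
      also have "\<dots> \<le> (\<Sum>i. mu {\<sigma> i})" by (rule mu_UN)
      also have "\<dots> \<le> (\<Sum>i. 2 * ennreal (cdiam (U i) powr ?s) + ennreal (e * (1/2) ^ Suc i))"
        by (rule suminf_le) (auto simp: mu_singleton \<sigma>(2) simp del: power_Suc)
      also have "\<dots> = (\<Sum>i. 2 * ennreal (cdiam (U i) powr ?s)) + (\<Sum>i. ennreal (e * (1/2) ^ Suc i))"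
        by (rule suminf_add[symmetric]) auto
      also have "(\<Sum>i. 2 * ennreal (cdiam (U i) powr ?s)) = 2 * S" unfolding SU by simp
      also have "(\<Sum>i. ennreal (e * (1/2) ^ Suc i)) = ennreal e"
        using sums_mult[OF power_half_series, of e] e by (intro suminf_ennreal_eq) auto
      finally show "content C \<le> 2 * S + ennreal e" .
    qed
    then show ?thesis unfolding c(1) using c(2)
      by (cases S) (auto simp: ennreal_mult[symmetric] simp flip: ennreal_numeral)
  qed
  then have "ennreal (c/2) \<le> hausdorff_delta ?s 1 C"
    unfolding hausdorff_delta_def by (intro Inf_greatest) auto
  also have "\<dots> \<le> hausdorff ?s C" unfolding hausdorff_def by (rule Sup_upper) auto
  finally have "ennreal (c/2) \<le> hausdorff ?s C" .
  moreover have "0 < ennreal (c/2)" using c(2) by simp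
  ultimately show ?thesis by (rule less_le_trans[rotated])
qed

section \<open>Compact subclasses of positive content\<close>

lemma chain_limit:
  assumes "\<And>n. length (F n) = n" "\<And>n. \<exists>a. F (Suc n) = F n @ [a]"
  obtains y where "\<And>n. restr y n = F n"
proof -
  define y where "y n = F (Suc n) ! n" for n
  have "restr y n = F n" for n
  proof (induction n)
    case (Suc n)
    obtain a where "F (Suc n) = F n @ [a]" using assms(2) by blast
    then show ?case using Suc assms(1)[of n] by (simp add: restr_def y_def nth_append)
  qed (use assms(1)[of 0] in \<open>simp add: restr_def\<close>)
  then show ?thesis by (rule that)
qed

lemma koenig:
  assumes len: "\<And>n. \<exists>l\<in>S. length l = n"
    and fin: "\<And>i. finite (B i)" and B: "\<And>l i. l \<in> S \<Longrightarrow> i < length l \<Longrightarrow> l ! i \<in> B i"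
    and closed: "\<And>l m. l \<in> S \<Longrightarrow> take m l \<in> S"
  obtains y where "\<And>n. restr y n \<in> S"
proof -
  \<comment> \<open>\<open>P l\<close> says that \<open>l\<close> has extensions in \<open>S\<close>
    of every length.\<close>
  define P where "P l \<longleftrightarrow> (\<forall>n. \<exists>t\<in>S. length t = length l + n \<and> take (length l) t = l)" for l
  have P0: "P []" using len by (auto simp: P_def)
  have step: "\<exists>a. P (l @ [a])" if l: "P l" for l
  proof (rule ccontr)
    assume "\<nexists>a. P (l @ [a])"
    then have "\<forall>a. \<exists>n. \<forall>t\<in>S. \<not> (length t = Suc (length l) + n \<and> take (Suc (length l)) t = l @ [a])"
      unfolding P_def by auto
    then obtain N where N: "\<And>a t. t \<in> S \<Longrightarrow> length t = Suc (length l) + N a \<Longrightarrow> take (Suc (length l)) t \<noteq> l @ [a]"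
      by metis
    \<comment> \<open>Each candidate entry \<open>a\<close> dies out at some height
      \<open>N a\<close>. Only finitely many entries occur at this position, so a member of
      \<open>S\<close> reaching past all these heights gives a contradiction after
      truncation.\<close>
    define M where "M = Max (N ` B (length l))"
    obtain t where t: "t \<in> S" "length t = length l + Suc M" "take (length l) t = l"
      using l unfolding P_def by blast
    define a where "a = t ! length l"
    have "a \<in> B (length l)" unfolding a_def using B t by simp
    then have "N a \<le> M" unfolding M_def using fin by simp
    then have "length (take (Suc (length l) + N a) t) = Suc (length l) + N a" using t by simp
    from N[OF closed[OF t(1)] this] show False
      using t by (simp add: take_Suc_conv_app_nth a_def)
  qed
  have "\<exists>F. \<forall>n. (length (F n) = n \<and> P (F n)) \<and> (\<exists>a. F (Suc n) = F n @ [a])"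
  proof (rule dependent_nat_choice)
    show "\<exists>x. length x = 0 \<and> P x" using P0 by simp
    show "\<exists>y. (length y = Suc n \<and> P y) \<and> (\<exists>a. y = x @ [a])" if x: "length x = n \<and> P x" for x n
    proof -
      obtain a where "P (x @ [a])" using step x by blast
      then show ?thesis using x by (intro exI[of _ "x @ [a]"]) auto
    qed
  qed
  then obtain F where F: "\<And>n. length (F n) = n" "\<And>n. P (F n)" "\<And>n. \<exists>a. F (Suc n) = F n @ [a]" by blast
  obtain y where y: "\<And>n. restr y n = F n" using chain_limit[OF F(1,3)] by blast
  have "restr y n \<in> S" for n
  proof -
    obtain t where "t \<in> S" "length t = length (F n) + 0" "take (length (F n)) t = F n"
      using F(2)[of n] unfolding P_def by blast
    then show ?thesis using y[of n] by simp
  qed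
  then show ?thesis by (rule that)
qed

section \<open>Codes of initial segments and their size\<close>

lemma seqcode_restr: "seqcode x n = list_encode (restr x n)"
  by (simp add: seqcode_def restr_def)

lemma len_seqcode[simp]: "len_code (seqcode x n) = n"
  by (simp add: seqcode_restr)
lemma nth_seqcode[simp]: "i < n \<Longrightarrow> nth_code (seqcode x n) i = x i"
  by (simp add: seqcode_restr)
lemma take_seqcode[simp]: "m \<le> n \<Longrightarrow> take_code m (seqcode x n) = seqcode x m"
  by (simp add: seqcode_restr min_def)

text \<open>The pairing function is monotone in both arguments. Entrywise bounds thus become bounds
  on codes, which is what makes the searches in \<open>adm_code\<close> and
  \<open>thick_code\<close> bounded.\<close>

lemma list_encode_mono:
  "length s = length t \<Longrightarrow> (\<And>i. i < length s \<Longrightarrow> s ! i \<le> t ! i) \<Longrightarrow> list_encode s \<le> list_encode t"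
proof (induction s t rule: list_induct2)
  case (Cons x xs y ys)
  have 1: "x \<le> y" using Cons.prems[of 0] by simp
  have 2: "list_encode xs \<le> list_encode ys"
    by (rule Cons.IH) (use Cons.prems[of "Suc i" for i] in auto)
  have "mono triangle"
    unfolding triangle_def by (intro monoI div_le_mono mult_le_mono) auto
  then have "triangle (x + list_encode xs) \<le> triangle (y + list_encode ys)"
    using 1 2 by (intro monoD[of triangle] add_mono)
  then show ?case using 1 by (simp add: prod_encode_def)
qed simp

lemma seqcode_mono: "(\<And>i. i < n \<Longrightarrow> x i \<le> y i) \<Longrightarrow> seqcode x n \<le> seqcode y n"
  unfolding seqcode_restr by (rule list_encode_mono) auto

lemma nth_code_le: "nth_code c i \<le> c"
proof -
  have *: "x \<in> set xs \<Longrightarrow> x \<le> list_encode xs" for x xs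
  proof (induction xs)
    case (Cons a xs)
    then show ?case
      using le_prod_encode_1[of a "list_encode xs"] le_prod_encode_2[of "list_encode xs" a] by (auto intro: le_SucI order_trans)
  qed simp
  show ?thesis
    using *[of "nth_code c i" "list_decode c"] by (auto simp: nth_code_def len_code_def)
qed

lemma len_code_le: "len_code c \<le> c"
proof -
  have "length xs \<le> list_encode xs" for xs
    by (induction xs) (auto intro: order_trans[OF _ le_prod_encode_2])
  from this[of "list_decode c"] show ?thesis by (simp add: len_code_def)
qed

text \<open>Here \<open>s\<close> codes an initial segment of \<open>X\<close>, \<open>c\<close> one
  of \<open>f\<close>, and \<open>t\<close> a partial witness below \<open>f\<close>; by
  \<open>list_encode_mono\<close> no such \<open>t\<close> exceeds \<open>c\<close>. Testing
  \<open>r\<close> at all shorter lengths too makes admissibility inherited by initial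
  segments.\<close>

definition adm_code :: "(nat \<Rightarrow> nat \<Rightarrow> bool) \<Rightarrow> nat \<Rightarrow> nat \<Rightarrow> bool" where
  "adm_code r s c \<longleftrightarrow> (\<exists>t<Suc c. len_code t = len_code s \<and>
     (\<forall>i<len_code s. nth_code t i \<le> nth_code c i) \<and>
     (\<forall>m<Suc (len_code s). r (take_code m s) (take_code m t)))"

lemma adm_code_seqcode:
  "adm_code r (seqcode x n) (seqcode f n) \<longleftrightarrow> 
    (\<exists>\<tau>. length \<tau> = n \<and> (\<forall>i<n. \<tau> ! i \<le> f i) \<and> (\<forall>m\<le>n. r (seqcode x m) (list_encode (take m \<tau>))))"
  (is "?L \<longleftrightarrow> ?R")
proof
  assume ?L
  then obtain t where "len_code t = n" "\<forall>i<n. nth_code t i \<le> f i"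
     "\<forall>m\<le>n. r (seqcode x m) (take_code m t)"
    unfolding adm_code_def by (auto simp: less_Suc_eq_le)
  then show ?R
    by (intro exI[of _ "list_decode t"]) (auto simp: len_code_def nth_code_def take_code_def)
next
  assume ?R
  then obtain \<tau> where \<tau>: "length \<tau> = n" "\<forall>i<n. \<tau> ! i \<le> f i"
    "\<forall>m\<le>n. r (seqcode x m) (list_encode (take m \<tau>))" by blast
  have "list_encode \<tau> \<le> seqcode f n"
    unfolding seqcode_restr by (rule list_encode_mono) (use \<tau> in auto)
  then show ?L unfolding adm_code_def using \<tau>
    by (intro exI[of _ "list_encode \<tau>"]) (auto simp: less_Suc_eq_le)
qed

lemma adm_code_mono:
  assumes "adm_code r (seqcode x n) (seqcode f n)" "m \<le> n"
  shows "adm_code r (seqcode x m) (seqcode f m)"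
proof -
  obtain \<tau> where \<tau>: "length \<tau> = n" "\<forall>i<n. \<tau> ! i \<le> f i"
    "\<forall>m\<le>n. r (seqcode x m) (list_encode (take m \<tau>))" using assms(1) unfolding adm_code_seqcode by blast
  then show ?thesis unfolding adm_code_seqcode using assms(2)
    by (intro exI[of _ "take m \<tau>"]) (auto simp: min_def)
qed

lemma adm_code_limit:
  assumes "\<And>n. adm_code r (seqcode x n) (seqcode f n)"
  shows "\<exists>y. \<forall>n. r (seqcode x n) (seqcode y n)"
proof -
  define S where "S = {\<tau>. (\<forall>i<length \<tau>. \<tau> ! i \<le> f i) \<and>
     (\<forall>m\<le>length \<tau>. r (seqcode x m) (list_encode (take m \<tau>)))}"
  obtain y where y: "\<And>n. restr y n \<in> S"
  proof (rule koenig[of S "\<lambda>i. {..f i}"])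
    show "\<exists>l\<in>S. length l = n" for n
      using assms[of n] unfolding adm_code_seqcode S_def by auto
    show "take m l \<in> S" if "l \<in> S" for l m
      using that by (auto simp: S_def min_def)
  qed (auto simp: S_def)
  have "r (seqcode x n) (seqcode y n)" for n
    using y[of n] by (auto simp: S_def seqcode_restr dest: spec[of _ n])
  then show ?thesis by blast
qed

text \<open>The number \<open>d\<close> codes a list of codes of strings, and the inequality
  compares the total weight with 2^-t after multiplication by 2^(d+t). For p \<le> q the code
  \<open>d\<close> itself serves as common exponent: the lengths of the listed strings, hence the
  exponents of their weights, are at most \<open>d\<close>, and the truncated subtraction is
  exact.\<close>

definition cheap_code :: "nat \<Rightarrow> nat \<Rightarrow> nat \<Rightarrow> nat \<Rightarrow> bool" where
  "cheap_code p q t d \<longleftrightarrow>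
     (\<Sum>i<len_code d. 2 ^ (d - p * len_code (nth_code d i) div q)) * 2 ^ t < (2::nat) ^ d"

lemma cheap_code_iff:
  assumes "p \<le> q" "0 < q"
  shows "cheap_code p q t d \<longleftrightarrow>
    (\<Sum>i<len_code d. (1/2) ^ (p * len_code (nth_code d i) div q)) < (1/2::real) ^ t"
proof -
  let ?e = "\<lambda>i. p * len_code (nth_code d i) div q"
  have le: "?e i \<le> d" for i
  proof -
    have "?e i \<le> q * len_code (nth_code d i) div q" by (intro div_le_mono mult_right_mono) (use assms in auto)
    also have "\<dots> \<le> d" using assms len_code_le[of "nth_code d i"] nth_code_le[of d i] by simp
    finally show ?thesis .
  qed
  have "(2::real) ^ (d - ?e i) = 2 ^ d * (1/2) ^ ?e i" for i
    by (simp add: power_diff[OF _ le] power_one_over)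
  then have "real (\<Sum>i<len_code d. 2 ^ (d - ?e i)) = 2 ^ d * (\<Sum>i<len_code d. (1/2) ^ ?e i)"
    by (simp only: of_nat_sum of_nat_power of_nat_numeral sum_distrib_left)
  then have *: "real ((\<Sum>i<len_code d. 2 ^ (d - ?e i)) * 2 ^ t) = 
     2 ^ d * (2 ^ t * (\<Sum>i<len_code d. (1/2) ^ ?e i))"
    by simp
  have "cheap_code p q t d \<longleftrightarrow> real ((\<Sum>i<len_code d. 2 ^ (d - ?e i)) * 2 ^ t) < real (2 ^ d)"
    unfolding cheap_code_def by (rule of_nat_less_iff[symmetric])
  also have "\<dots> \<longleftrightarrow> 2 ^ d * (2 ^ t * (\<Sum>i<len_code d. (1/2::real) ^ ?e i)) < 2 ^ d * 1"
    unfolding * by simp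
  also have "\<dots> \<longleftrightarrow> 2 ^ t * (\<Sum>i<len_code d. (1/2::real) ^ ?e i) < 1"
    by (subst mult_less_cancel_left_pos) auto
  also have "\<dots> \<longleftrightarrow> (\<Sum>i<len_code d. (1/2::real) ^ ?e i) < (1/2) ^ t"
    by (simp add: power_one_over pos_less_divide_eq mult.commute)
  finally show ?thesis .
qed

definition bcode :: "bool list \<Rightarrow> nat" where
  "bcode \<sigma> = list_encode (map (\<lambda>b. if b then 1 else 0) \<sigma>)"

lemma bcode_restr: "bcode (restr X n) = seqcode (b2n X) n"
  by (simp add: bcode_def seqcode_restr restr_def b2n_def comp_def)

lemma len_bcode[simp]: "len_code (bcode \<sigma>) = length \<sigma>"
  by (simp add: bcode_def)

lemma inj_bcode: "inj bcode"
proof (rule injI)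
  fix \<sigma> \<tau> assume "bcode \<sigma> = bcode \<tau>"
  moreover have "inj (\<lambda>b. if b then 1 else (0::nat))" by (rule injI) (auto split: if_splits)
  ultimately show "\<sigma> = \<tau>" unfolding bcode_def by (simp add: list_encode_eq inj_map_eq_map)
qed

text \<open>With \<open>n\<close> the length of \<open>c\<close>: no cover whose code is at most \<open>n\<close> and whose cost is below \<open>2\<^sup>-\<^sup>t\<close>
  covers the clopen set of the sequences whose restriction to \<open>n\<close> is admissible for \<open>c\<close>.\<close>

definition thick_code :: "(nat \<Rightarrow> nat \<Rightarrow> bool) \<Rightarrow> nat \<Rightarrow> nat \<Rightarrow> nat \<Rightarrow> nat \<Rightarrow> bool" where
  "thick_code r p q t c \<longleftrightarrow> (\<forall>d<Suc (len_code c). cheap_code p q t d \<longrightarrow>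
     (\<exists>s<Suc c. len_code s = len_code c \<and> (\<forall>i<len_code c. nth_code s i < 2) \<and> adm_code r s c \<and>
       (\<forall>i<len_code d. \<forall>m<Suc (len_code c). take_code m s \<noteq> nth_code d i)))"

definition proj_set :: "(nat \<Rightarrow> nat \<Rightarrow> bool) \<Rightarrow> (nat \<Rightarrow> bool) set" where
  "proj_set r = {X. \<exists>y. \<forall>n. r (seqcode (b2n X) n) (seqcode y n)}"

definition adm_set :: "(nat \<Rightarrow> nat \<Rightarrow> bool) \<Rightarrow> (nat \<Rightarrow> nat) \<Rightarrow> (nat \<Rightarrow> bool) set" where
  "adm_set r f = {X. \<forall>n. adm_code r (seqcode (b2n X) n) (seqcode f n)}"

lemma adm_set_subset: "adm_set r f \<subseteq> proj_set r"
  unfolding adm_set_def proj_set_def using adm_code_limit by blast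

lemma thick_exists:
  assumes pq: "p \<le> q" "0 < q"
    and c: "ennreal ((1/2) ^ t) < weight.content (dyadic_weight p q) (proj_set r)"
  obtains f where "\<And>n. thick_code r p q t (seqcode f n)"
proof -
  interpret weight "dyadic_weight p q" by (rule weight_dyadic)
  let ?c = "ennreal ((1/2) ^ t)"
  define Eb where "Eb a = {X. \<exists>y. (\<forall>i<length a. y i \<le> a ! i) \<and> (\<forall>n. r (seqcode (b2n X) n) (seqcode y n))}" for a
  \<comment> \<open>Each witness has some bound on its next entry, so \<open>Eb a\<close> is the
    increasing union of the sets with that entry bounded, and by \<open>content_incseq\<close> they
    cannot all have content at most 2^-t. Bounds at least 1 ensure that the code of a 0-1 sequence
    is at most that of the initial segment of \<open>f\<close>, as the bound on \<open>s\<close> in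
    \<open>thick_code\<close> requires.\<close>
  have step: "\<exists>k\<ge>1. ?c < content (Eb (a @ [k]))" if a: "?c < content (Eb a)" for a
  proof (rule ccontr)
    assume "\<not> (\<exists>k\<ge>1. ?c < content (Eb (a @ [k])))"
    then have le: "content (Eb (a @ [Suc k])) \<le> ?c" for k by (simp add: not_less)
    have "content (\<Union>k. Eb (a @ [Suc k])) \<le> ?c"
    proof (rule content_incseq[OF _ le])
      show "incseq (\<lambda>k. Eb (a @ [Suc k]))"
      proof (intro monoI subsetI)
        fix k l :: nat and X assume kl: "k \<le> l" and "X \<in> Eb (a @ [Suc k])"
        then obtain y where y: "\<forall>i<Suc (length a). y i \<le> (a @ [Suc k]) ! i" 
          "\<forall>n. r (seqcode (b2n X) n) (seqcode y n)" unfolding Eb_def by auto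
        have "y i \<le> (a @ [Suc l]) ! i" if "i < Suc (length a)" for i
          using y(1) that kl by (force simp: nth_append split: if_splits)
        then show "X \<in> Eb (a @ [Suc l])" using y(2) unfolding Eb_def by auto
      qed
    qed
    moreover have "Eb a \<subseteq> (\<Union>k. Eb (a @ [Suc k]))"
    proof
      fix X assume "X \<in> Eb a"
      then obtain y where y: "\<forall>i<length a. y i \<le> a ! i" "\<forall>n. r (seqcode (b2n X) n) (seqcode y n)"
        unfolding Eb_def by auto
      have "X \<in> Eb (a @ [Suc (y (length a))])" unfolding Eb_def
        using y by (auto intro!: exI[of _ y] simp: nth_append less_Suc_eq)
      then show "X \<in> (\<Union>k. Eb (a @ [Suc k]))" by blast
    qed
    ultimately have "content (Eb a) \<le> ?c" using content_mono order_trans by blast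
    then show False using a by simp
  qed
  have "\<exists>F. \<forall>n. (length (F n) = n \<and> ?c < content (Eb (F n)) \<and> (\<forall>i<n. 1 \<le> F n ! i)) \<and>
      (\<exists>a. F (Suc n) = F n @ [a])"
  proof (rule dependent_nat_choice)
    have "Eb [] = proj_set r" by (simp add: Eb_def proj_set_def)
    then show "\<exists>x. length x = 0 \<and> ?c < content (Eb x) \<and> (\<forall>i<0. 1 \<le> x ! i)" using c by auto
    show "\<exists>y. (length y = Suc n \<and> ?c < content (Eb y) \<and> (\<forall>i<Suc n. 1 \<le> y ! i)) \<and> (\<exists>a. y = x @ [a])"
      if x: "length x = n \<and> ?c < content (Eb x) \<and> (\<forall>i<n. 1 \<le> x ! i)" for x n
    proof -
      obtain k where "k \<ge> 1" "?c < content (Eb (x @ [k]))" using step x by blast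
      then show ?thesis using x by (intro exI[of _ "x @ [k]"]) (auto simp: nth_append)
    qed
  qed
  then obtain F where F: "\<And>n. length (F n) = n" "\<And>n. ?c < content (Eb (F n))"
    "\<And>n i. i < n \<Longrightarrow> 1 \<le> F n ! i" "\<And>n. \<exists>a. F (Suc n) = F n @ [a]" by blast
  obtain f where f: "\<And>n. restr f n = F n" using chain_limit[OF F(1,4)] by blast
  have f1: "1 \<le> f i" for i using F(3)[of i "Suc i"] f[of "Suc i", symmetric] by simp
  have "thick_code r p q t (seqcode f n)" for n
    unfolding thick_code_def
  proof (intro allI impI, rule ccontr)
    fix d
    assume "cheap_code p q t d" and no: "\<not> (\<exists>s<Suc (seqcode f n). len_code s = len_code (seqcode f n) \<and>
      (\<forall>i<len_code (seqcode f n). nth_code s i < 2) \<and> adm_code r s (seqcode f n) \<and>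
      (\<forall>i<len_code d. \<forall>m<Suc (len_code (seqcode f n)). take_code m s \<noteq> nth_code d i))"
    then have cheap: "(\<Sum>i<len_code d. (1/2) ^ (p * len_code (nth_code d i) div q)) < (1/2::real) ^ t"
      using cheap_code_iff[OF pq] by blast
    \<comment> \<open>Entries of \<open>d\<close> need not code binary strings: \<open>D i\<close>
      is empty in that case and a singleton otherwise, by injectivity of
      \<open>bcode\<close>.\<close>
    define D where "D i = {\<sigma>. bcode \<sigma> = nth_code d i}" for i
    \<comment> \<open>The initial segment of length \<open>n\<close> of a member of
      \<open>Eb (F n)\<close> is admissible, its witness being bounded by \<open>f\<close> up to
      \<open>n\<close>; by the assumed failure of thickness one of its prefixes is listed in
      \<open>d\<close>.\<close>
    have "covers (\<Union>i\<in>{..<len_code d}. D i) (Eb (F n))"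
      unfolding covers_def
    proof
      fix X assume "X \<in> Eb (F n)"
      then obtain y where y: "\<forall>i<n. y i \<le> f i" "\<forall>n. r (seqcode (b2n X) n) (seqcode y n)"
        unfolding Eb_def f[symmetric] by auto
      let ?s = "seqcode (b2n X) n"
      have "?s < Suc (seqcode f n)"
        unfolding less_Suc_eq_le by (rule seqcode_mono) (use f1 in \<open>simp add: b2n_def\<close>)
      moreover have "len_code ?s = len_code (seqcode f n)" by simp
      moreover have "\<forall>i<len_code (seqcode f n). nth_code ?s i < 2" by (simp add: b2n_def)
      moreover have "adm_code r ?s (seqcode f n)" unfolding adm_code_seqcode
        using y by (intro exI[of _ "restr y n"]) (auto simp: seqcode_restr min_def)
      ultimately obtain i m where "i < len_code d" "m \<le> n" "take_code m ?s = nth_code d i"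
        using no by (metis len_seqcode less_Suc_eq_le)
      then have "restr X m \<in> D i" by (simp add: D_def bcode_restr)
      then show "\<exists>m. restr X m \<in> (\<Union>i\<in>{..<len_code d}. D i)" using \<open>i < len_code d\<close> by blast
    qed
    then have "content (Eb (F n)) \<le> mu (\<Union>i\<in>{..<len_code d}. D i)" by (rule content_le)
    also have "\<dots> \<le> (\<Sum>i<len_code d. mu (D i))"
      unfolding mu_def by (rule emeasure_subadditive_finite) auto
    also have "\<dots> \<le> (\<Sum>i<len_code d. ennreal ((1/2) ^ (p * len_code (nth_code d i) div q)))"
    proof (rule sum_mono)
      fix i
      show "mu (D i) \<le> ennreal ((1/2) ^ (p * len_code (nth_code d i) div q))"
      proof (cases "D i = {}")
        case False
        then obtain \<sigma> where \<sigma>: "bcode \<sigma> = nth_code d i" by (auto simp: D_def)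
        have "\<tau> = \<sigma>" if "\<tau> \<in> D i" for \<tau>
          using that unfolding D_def \<sigma>[symmetric] by (simp add: inj_eq[OF inj_bcode])
        then have "D i \<subseteq> {\<sigma>}" by blast
        then have "mu (D i) \<le> mu {\<sigma>}" by (rule mu_mono)
        then show ?thesis unfolding mu_singleton dyadic_weight_def \<sigma>[symmetric] by simp
      qed simp
    qed
    also have "\<dots> = ennreal (\<Sum>i<len_code d. (1/2) ^ (p * len_code (nth_code d i) div q))"
      by (rule sum_ennreal) simp
    also have "\<dots> < ?c" using cheap by (intro ennreal_lessI) auto
    finally show False using F(2)[of n] by (metis less_asym)
  qed
  then show ?thesis by (rule that)
qed

text \<open>Suppose a cover \<open>D\<close> were too cheap. By compactness no string of some length
  \<open>n\<close> is both admissible and free of prefixes in \<open>D\<close>, so finitely many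
  strings of \<open>D\<close> suffice, and the code of this finite cover contradicts
  thickness.\<close>

lemma content_adm_set:
  assumes pq: "p \<le> q" "0 < q" and thick: "\<And>n. thick_code r p q t (seqcode f n)"
  shows "ennreal ((1/2) ^ t) \<le> weight.content (dyadic_weight p q) (adm_set r f)"
proof -
  interpret weight "dyadic_weight p q" by (rule weight_dyadic)
  let ?c = "ennreal ((1/2) ^ t)"
  show ?thesis unfolding content_def
  proof (rule INF_greatest, rule ccontr)
    fix D assume "D \<in> {D. covers D (adm_set r f)}" and "\<not> ?c \<le> mu D"
    then have cov: "covers D (adm_set r f)" and lt: "mu D < ?c" by auto
    define S where "S = {\<sigma>. adm_code r (bcode \<sigma>) (seqcode f (length \<sigma>)) \<and> (\<forall>m\<le>length \<sigma>. take m \<sigma> \<notin> D)}"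
    have S: "restr X n \<in> S \<longleftrightarrow> adm_code r (seqcode (b2n X) n) (seqcode f n) \<and> (\<forall>m\<le>n. restr X m \<notin> D)" for X n
      by (auto simp: S_def bcode_restr min_def)
    have "\<exists>n. \<forall>l\<in>S. length l \<noteq> n"
    proof (rule ccontr)
      assume "\<nexists>n. \<forall>l\<in>S. length l \<noteq> n"
      then have len: "\<exists>l\<in>S. length l = n" for n by blast
      have "take m l \<in> S" if "l \<in> S" for l m
      proof -
        define X where "X i = (if i < length l then l ! i else False)" for i
        have l: "l = restr X (length l)" by (rule nth_equalityI) (auto simp: X_def)
        have "restr X (min m (length l)) \<in> S"
          using that l S[of X "length l"] S[of X "min m (length l)"] adm_code_mono[of r "b2n X" "length l" f "min m (length l)"]
          by auto
        then show ?thesis using l by (metis take_restr)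
      qed
      then obtain X where X: "\<And>n. restr X n \<in> S" using koenig[of S "\<lambda>_. UNIV"] len by auto
      then have "X \<in> adm_set r f" unfolding adm_set_def using S by blast
      then obtain n where "restr X n \<in> D" using cov unfolding covers_def by blast
      then show False using X[of n] S by blast
    qed
    then obtain n where n: "\<And>X. restr X n \<notin> S" by (metis length_restr)
    define Dn where "Dn = {\<sigma>\<in>D. length \<sigma> \<le> n}"
    have fin: "finite Dn"
      by (rule finite_subset[OF _ finite_lists_length_le[of "UNIV :: bool set" n]]) (auto simp: Dn_def)
    obtain ds where ds: "set ds = Dn" "distinct ds" using finite_distinct_list[OF fin] by blast
    define d where "d = list_encode (map bcode ds)"
    have "ennreal (\<Sum>i<len_code d. (1/2) ^ (p * len_code (nth_code d i) div q)) = 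
      (\<Sum>i<length ds. dyadic_weight p q (length (ds ! i)))"
      by (simp add: d_def dyadic_weight_def sum_ennreal[symmetric] del: sum_ennreal)
    also have "\<dots> = (\<Sum>\<sigma>\<in>Dn. dyadic_weight p q (length \<sigma>))"
      unfolding ds(1)[symmetric] using ds(2)
      by (intro sum.reindex_bij_betw[OF bij_betw_nth]) auto
    also have "\<dots> = mu Dn" by (rule mu_finite[OF fin, symmetric])
    also have "\<dots> \<le> mu D" by (rule mu_mono) (auto simp: Dn_def)
    also have "\<dots> < ?c" by (rule lt)
    finally have "cheap_code p q t d" unfolding cheap_code_iff[OF pq]
      by (subst (asm) ennreal_less_iff) (auto intro: sum_nonneg)
    \<comment> \<open>The level must reach \<open>n\<close>, where the finite cover is complete, and
      also \<open>d\<close>, because \<open>thick_code\<close> tests at level \<open>N\<close> only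
      covers whose code is at most \<open>N\<close>.\<close>
    define N where "N = max n d"
    have "d < Suc (len_code (seqcode f N))" by (simp add: N_def)
    then obtain s where s: "len_code s = N" "\<And>i. i < N \<Longrightarrow> nth_code s i < 2" "adm_code r s (seqcode f N)"
      "\<And>i m. i < len_code d \<Longrightarrow> m \<le> N \<Longrightarrow> take_code m s \<noteq> nth_code d i"
      using thick[of N] \<open>cheap_code p q t d\<close> unfolding thick_code_def by (auto simp: less_Suc_eq_le)
    define X where "X i \<longleftrightarrow> nth_code s i = 1" for i
    have sX: "s = seqcode (b2n X) N"
      by (rule code_eqI) (use s(1,2) in \<open>force simp: X_def b2n_def\<close>)+
    have "adm_code r (seqcode (b2n X) n) (seqcode f n)"
      by (rule adm_code_mono[OF s(3)[unfolded sX]]) (simp add: N_def)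
    moreover have "restr X m \<notin> D" if "m \<le> n" for m
    proof
      assume "restr X m \<in> D"
      then have "restr X m \<in> set ds" using that by (simp add: ds Dn_def)
      then obtain i where i: "i < length ds" "ds ! i = restr X m" by (meson in_set_conv_nth)
      then have "nth_code d i = take_code m s"
        using that by (simp add: d_def bcode_restr sX N_def)
      moreover have "i < len_code d" "m \<le> N" using i that by (auto simp: d_def N_def)
      ultimately show False using s(4) by metis
    qed
    ultimately show False using n S by blast
  qed
qed

section \<open>Effectivity\<close>

lemma pred_adm_code:
  assumes "pred_rec_in g 2 (\<lambda>xs. r (xs!0) (xs!1))" "total_rec_in g k s" "total_rec_in g k c"
  shows "pred_rec_in g k (\<lambda>xs. adm_code r (s xs) (c xs))"
proof (rule pred_comp2[OF _ assms(2,3)])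
  show "pred_rec_in g 2 (\<lambda>xs. adm_code r (xs!0) (xs!1))"
    unfolding adm_code_def
    by (intro pred_logic rec_codes rec_arith rec_leaf pred_comp2[OF assms(1)]) auto
qed

lemma pred_cheap_code:
  assumes "total_rec_in g k d"
  shows "pred_rec_in g k (\<lambda>xs. cheap_code p q t (d xs))"
proof (rule pred_comp1[OF _ assms])
  show "pred_rec_in g 1 (\<lambda>xs. cheap_code p q t (xs!0))"
    unfolding cheap_code_def
    by (intro pred_logic rec_codes rec_arith rec_const rec_leaf) auto
qed

lemma pred_thick_code:
  assumes "pred_rec_in g 2 (\<lambda>xs. r (xs!0) (xs!1))" "total_rec_in g k c"
  shows "pred_rec_in g k (\<lambda>xs. thick_code r p q t (c xs))"
proof (rule pred_comp1[OF _ assms(2)])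
  show "pred_rec_in g 1 (\<lambda>xs. thick_code r p q t (xs!0))"
    unfolding thick_code_def
    by (intro pred_logic rec_codes rec_arith rec_const rec_leaf pred_adm_code[OF assms(1)] pred_cheap_code) auto
qed

lemma basis_subclass:
  fixes s :: real
  assumes s: "s \<in> \<rat>" "0 < s" "s < 1" and B: "basis_Sigma11 B" and E: "Sigma11_cantor E"
    and pos: "hausdorff s E > 0"
  shows "\<exists>f\<in>B. \<exists>C. Pi01_in f C \<and> C \<subseteq> E \<and> hausdorff s C > 0"
proof -
  obtain p q :: nat where q: "q \<noteq> 0" "\<bar>s\<bar> = real p / real q"
    using Rats_abs_nat_div_natE[OF s(1)] by metis
  then have sq: "s = real p / real q" using s by simp
  have pq: "p \<le> q" "0 < q" "0 < p" using s q sq by (auto simp: field_simps intro: gr0I)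
  interpret weight "dyadic_weight p q" by (rule weight_dyadic)
  obtain R where R: "pred_rec_in no_oracle 2 R" "b2n ` E = {x. \<exists>y. \<forall>n. R [seqcode x n, seqcode y n]}"
    using E unfolding Sigma11_cantor_def Sigma11_def by blast
  define r where "r a b = R [a, b]" for a b
  have r: "pred_rec_in no_oracle 2 (\<lambda>xs. r (xs!0) (xs!1))"
  proof (rule pred_cong[OF R(1)])
    fix xs :: "nat list" assume "length xs = 2"
    then obtain a b where "xs = [a, b]" by (auto simp: numeral_2_eq_2 length_Suc_conv)
    then show "R xs = r (xs!0) (xs!1)" by (simp add: r_def)
  qed
  have "X = Y" if "b2n X = b2n Y" for X Y
  proof
    show "X i = Y i" for i using fun_cong[OF that, of i] by (auto simp: b2n_def split: if_splits)
  qed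
  then have "inj b2n" by (rule injI)
  then have "X \<in> E \<longleftrightarrow> b2n X \<in> b2n ` E" for X by (rule inj_image_mem_iff[symmetric])
  then have EX: "E = proj_set r" unfolding proj_set_def r_def R(2) by blast
  have "content E \<noteq> 0" using hausdorff_eq_0[OF pq(2,3)] pos sq by auto
  then obtain c where c: "content E = ennreal c" "0 < c"
    using content_le_1[of E] by (cases "content E") (auto simp: top_unique)
  obtain t where t: "(1/2) ^ t < c" using real_arch_pow_inv[OF c(2), of "1/2"] by auto
  then have "ennreal ((1/2) ^ t) < content (proj_set r)"
    unfolding EX[symmetric] c(1) using c(2) by (intro ennreal_lessI) auto
  then obtain f0 where f0: "\<And>n. thick_code r p q t (seqcode f0 n)"
    by (rule thick_exists[OF pq(1,2)]) blast
  define G where "G = {f. \<forall>n. thick_code r p q t (seqcode f n)}"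
  \<comment> \<open>\<open>G\<close> is even a \<Pi>01 class; the existential witness is vacuous,
    and the predicate reads only its first argument.\<close>
  have "Sigma11 G" unfolding Sigma11_def
  proof (intro exI conjI)
    show "pred_rec_in no_oracle 2 (\<lambda>xs. thick_code r p q t (xs!0))"
      by (rule pred_thick_code[OF r]) (simp add: rec_nth)
    show "G = {x. \<exists>y. \<forall>n. thick_code r p q t ([seqcode x n, seqcode y n] ! 0)}"
      by (simp add: G_def)
  qed
  moreover have "G \<noteq> {}" using f0 by (auto simp: G_def)
  ultimately obtain f where f: "f \<in> B" "f \<in> G" using B unfolding basis_Sigma11_def by blast
  have "Pi01_in f (adm_set r f)" unfolding Pi01_in_def
  proof (intro exI conjI)
    \<comment> \<open>Given only the code of an initial segment of \<open>X\<close>, the matching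
      initial segment of \<open>f\<close> is rebuilt from the oracle by means of the length.\<close>
    show "pred_rec_in f 1 (\<lambda>xs. adm_code r (xs!0) (seqcode f (len_code (xs!0))))"
      by (intro pred_adm_code pred_no_oracle[OF r] rec_seqcode rec_oracle rec_codes rec_nth) auto
    show "adm_set r f = {X. \<forall>n. adm_code r ([seqcode (b2n X) n] ! 0) (seqcode f (len_code ([seqcode (b2n X) n] ! 0)))}"
      by (simp add: adm_set_def)
  qed
  moreover have "adm_set r f \<subseteq> E" unfolding EX by (rule adm_set_subset)
  moreover have "hausdorff s (adm_set r f) > 0" unfolding sq
  proof (rule hausdorff_pos[OF pq(2,3)])
    have "0 < ennreal ((1/2) ^ t)" by simp
    also have "\<dots> \<le> content (adm_set r f)"
      by (rule content_adm_set[OF pq(1,2)]) (use f(2) in \<open>simp add: G_def\<close>)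
    finally show "0 < content (adm_set r f)" .
  qed
  ultimately show ?thesis using f(1) by blast
qed

section \<open>The Kleene basis theorem\<close>

lemma seqcode_Suc: "seqcode x (Suc n) = snoc_code (seqcode x n) (x n)"
  by (simp add: snoc_code_def seqcode_def)

text \<open>A member \<open>x\<close> and its witness \<open>y\<close> are paired into one sequence
  \<open>z\<close>, so that a single path is sought and \<open>x\<close> is its first component.
  That a finite sequence has no extension to a path is a \<Pi>11 property, hence reducible to
  \<open>Ob\<close>; with this oracle the path can be built one least extendible value at a
  time.\<close>

lemma kleene_basis:
  assumes Ob: "Pi11_complete Ob"
  shows "basis_Sigma11 {x. total_rec_in (char_fun Ob) 1 (\<lambda>xs. x (hd xs))}"
  unfolding basis_Sigma11_def
proof (intro allI impI, elim conjE)
  fix A :: "(nat \<Rightarrow> nat) set" assume A: "Sigma11 A" "A \<noteq> {}"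
  obtain R where R: "pred_rec_in no_oracle 2 R" "A = {x. \<exists>y. \<forall>n. R [seqcode x n, seqcode y n]}"
    using A(1) unfolding Sigma11_def by blast
  define r where "r c = R [map_code fst_code c, map_code snd_code c]" for c
  have r: "pred_rec_in no_oracle 1 (\<lambda>xs. r (xs!0))"
  proof -
    have "pred_rec_in no_oracle 2 (\<lambda>xs. R [xs!0, xs!1])"
    proof (rule pred_cong[OF R(1)])
      fix xs :: "nat list" assume "length xs = 2"
      then obtain a b where "xs = [a, b]" by (auto simp: numeral_2_eq_2 length_Suc_conv)
      then show "R xs = R [xs!0, xs!1]" by simp
    qed
    then show ?thesis unfolding r_def
      by (rule pred_comp2) (intro rec_map_code rec_codes rec_leaf; simp)+
  qed
  have r_seq: "r (seqcode z n) \<longleftrightarrow> R [seqcode (\<lambda>i. fst_code (z i)) n, seqcode (\<lambda>i. snd_code (z i)) n]" for z n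
    by (simp add: r_def map_code_def seqcode_def comp_def)
  \<comment> \<open>The existential over \<open>m\<close> serves two purposes: at the length of
    \<open>n\<close> it can say that \<open>z\<close> does not extend \<open>n\<close>, and at any
    length that \<open>z\<close> leaves the tree. Thus \<open>T\<close> consists of the codes that
    do not extend to a path.\<close>
  define T where "T = {n. \<forall>z. \<exists>m. (len_code (seqcode z m) = len_code n \<and> seqcode z m \<noteq> n) \<or> \<not> r (seqcode z m)}"
  have "Pi11_nat T" unfolding Pi11_nat_def
  proof (intro exI conjI)
    show "pred_rec_in no_oracle 2 (\<lambda>xs. (len_code (xs!1) = len_code (xs!0) \<and> xs!1 \<noteq> xs!0) \<or> \<not> r (xs!1))"
      by (intro pred_logic rec_codes rec_nth pred_comp1[OF r]) auto
    show "T = {n. \<forall>z. \<exists>m. (len_code ([n, seqcode z m] ! 1) = len_code ([n, seqcode z m] ! 0) \<and>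
        [n, seqcode z m] ! 1 \<noteq> [n, seqcode z m] ! 0) \<or> \<not> r ([n, seqcode z m] ! 1)}"
      by (simp add: T_def)
  qed
  then obtain h where h: "total_rec_in no_oracle 1 (\<lambda>xs. h (hd xs))" "\<And>n. n \<in> T \<longleftrightarrow> h n \<in> Ob"
    using Ob unfolding Pi11_complete_def by blast
  define good where "good c \<longleftrightarrow> c \<notin> T" for c
  have good_seq: "good (seqcode z k) \<longleftrightarrow> (\<exists>z'. seqcode z' k = seqcode z k \<and> (\<forall>m. r (seqcode z' m)))" for z k
    unfolding good_def T_def by auto
  let ?O = "char_fun Ob"
  have pgood: "pred_rec_in ?O 1 (\<lambda>xs. good (xs!0))"
  proof -
    have "total_rec_in ?O 1 (\<lambda>xs. h (xs!0))"
      by (rule rec_cong[OF rec_no_oracle[OF h(1)]]) (auto simp: length_Suc_conv)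
    then have "pred_rec_in ?O 1 (\<lambda>xs. ?O (h (xs!0)) = 0)"
      by (intro pred_logic rec_oracle rec_const)
    then show ?thesis by (rule pred_cong) (simp add: good_def h(2) char_fun_def)
  qed
  \<comment> \<open>The disjunct \<open>\<not> good c\<close> makes the search total; along the
    construction it never applies, since \<open>good\<close> is preserved.\<close>
  define step where "step c = snoc_code c (LEAST v. good (snoc_code c v) \<or> \<not> good c)" for c
  have good_step: "\<exists>v. good (snoc_code c v)" if "good c" for c
  proof -
    from that obtain z where z: "\<And>m. len_code (seqcode z m) = len_code c \<Longrightarrow> seqcode z m = c"
      "\<And>m. r (seqcode z m)" unfolding good_def T_def by blast
    have "c = seqcode z (len_code c)" using z(1)[of "len_code c"] by simp
    then have "snoc_code c (z (len_code c)) = seqcode z (Suc (len_code c))"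
      by (simp add: seqcode_Suc)
    moreover have "good (seqcode z (Suc (len_code c)))" unfolding good_seq using z(2) by blast
    ultimately have "good (snoc_code c (z (len_code c)))" by simp
    then show ?thesis by blast
  qed
  have rec_step: "total_rec_in ?O 1 (\<lambda>xs. step (xs!0))"
    unfolding step_def
  proof (intro rec_snoc_code rec_Least rec_nth)
    show "pred_rec_in ?O (Suc 1) (\<lambda>ys. good (snoc_code (tl ys!0) (ys!0)) \<or> \<not> good (tl ys!0))"
      by (intro pred_logic pred_comp1[OF pgood] rec_codes rec_leaf) auto
    show "\<exists>v. good (snoc_code (xs!0) v) \<or> \<not> good (xs!0)" for xs using good_step by blast
  qed simp
  \<comment> \<open>The iteration starts from 0, the code of the empty sequence.\<close>
  define F where "F n = (step ^^ n) 0" for n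
  have F0: "good (F 0)"
  proof -
    obtain x y where xy: "\<forall>n. R [seqcode x n, seqcode y n]" using A(2) R(2) by blast
    have "\<forall>m. r (seqcode (\<lambda>i. prod_encode (x i, y i)) m)"
      unfolding r_seq using xy by (simp add: fst_code_def snd_code_def)
    then have "good (seqcode (\<lambda>i. prod_encode (x i, y i)) 0)" unfolding good_seq by blast
    then show ?thesis by (simp add: F_def seqcode_def)
  qed
  have FS: "\<exists>v. F (Suc n) = snoc_code (F n) v \<and> (good (F n) \<longrightarrow> good (F (Suc n)))" for n
  proof -
    have "good (snoc_code c (LEAST v. good (snoc_code c v) \<or> \<not> good c))" if "good c" for c
      using LeastI_ex[of "\<lambda>v. good (snoc_code c v) \<or> \<not> good c"] good_step[OF that] that by blast
    then show ?thesis by (auto simp: F_def step_def)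
  qed
  have good_F: "good (F n)" for n by (induction n) (use F0 FS in blast)+
  have FL: "length (list_decode (F n)) = n" for n
  proof (induction n)
    case (Suc n)
    then show ?case using FS[of n] by (auto simp: snoc_code_def)
  qed (simp add: F_def)
  obtain z where z: "\<And>n. restr z n = list_decode (F n)"
  proof (rule chain_limit[of "\<lambda>n. list_decode (F n)"])
    show "\<exists>a. list_decode (F (Suc n)) = list_decode (F n) @ [a]" for n
      using FS[of n] by (auto simp: snoc_code_def)
  qed (use FL in auto)
  then have zF: "seqcode z n = F n" for n by (simp add: seqcode_restr)
  have rz: "r (seqcode z n)" for n
  proof -
    have "good (seqcode z n)" using good_F zF by simp
    then obtain z' where "seqcode z' n = seqcode z n" "r (seqcode z' n)" unfolding good_seq by blast
    then show ?thesis by simp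
  qed
  define x where "x i = fst_code (z i)" for i
  have "x \<in> A" unfolding R(2) x_def using rz unfolding r_seq by blast
  moreover have "total_rec_in ?O 1 (\<lambda>xs. x (hd xs))"
  proof -
    have zi: "z i = nth_code (F (Suc i)) i" for i by (simp add: zF[symmetric])
    have "total_rec_in ?O 1 (\<lambda>xs. fst_code (nth_code ((step ^^ Suc (xs!0)) 0) (xs!0)))"
      by (intro rec_codes rec_funpow rec_step rec_const rec_arith rec_nth) auto
    then show ?thesis
      by (rule rec_cong) (auto simp: x_def zi F_def length_Suc_conv)
  qed
  ultimately show "A \<inter> {x. total_rec_in ?O 1 (\<lambda>xs. x (hd xs))} \<noteq> {}" by blast
qed

theorem mainTheorem13:
  shows "(\<forall>(s::real) B E. s \<in> \<rat> \<and> 0 < s \<and> s < 1 \<and> basis_Sigma11 B \<and> Sigma11_cantor E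
            \<and> hausdorff s E > 0
          \<longrightarrow> (\<exists>f \<in> B. \<exists>C. Pi01_in f C \<and> C \<subseteq> E \<and> hausdorff s C > 0))
       \<and> (\<forall>(s::real) E Ob. s \<in> \<rat> \<and> 0 < s \<and> s < 1 \<and> Pi11_complete Ob \<and> Sigma11_cantor E
            \<and> hausdorff s E > 0
          \<longrightarrow> (\<exists>C. Pi01_in (char_fun Ob) C \<and> C \<subseteq> E \<and> hausdorff s C > 0))"
proof (intro conjI allI impI; elim conjE)
  fix s :: real and B E
  assume "s \<in> \<rat>" "0 < s" "s < 1" "basis_Sigma11 B" "Sigma11_cantor E" "hausdorff s E > 0"
  then show "\<exists>f \<in> B. \<exists>C. Pi01_in f C \<and> C \<subseteq> E \<and> hausdorff s C > 0" by (rule basis_subclass)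
next
  fix s :: real and E Ob
  assume *: "s \<in> \<rat>" "0 < s" "s < 1" "Pi11_complete Ob" "Sigma11_cantor E" "hausdorff s E > 0"
  obtain f C where f: "total_rec_in (char_fun Ob) 1 (\<lambda>xs. f (hd xs))"
    and C: "Pi01_in f C" "C \<subseteq> E" "hausdorff s C > 0"
    using basis_subclass[OF *(1-3) kleene_basis[OF *(4)] *(5,6)] by blast
  \<comment> \<open>Since \<open>f\<close> is recursive in \<open>Ob\<close>, a program for
    \<open>f\<close> can be substituted for the oracle \<open>f\<close> in the predicate defining
    \<open>C\<close>.\<close>
  have "Pi01_in (char_fun Ob) C"
    using C(1) pred_rec_in_trans[OF _ f] unfolding Pi01_in_def by blast
  then show "\<exists>C. Pi01_in (char_fun Ob) C \<and> C \<subseteq> E \<and> hausdorff s C > 0" using C by blast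
qed

end
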